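(* Let $\Gamma$ be a connected negative definite plumbing graph. If $\Gamma$ is rational, then $\mathbb H^*_{red}(\Gamma,k)=0$ for any $k\in\mathrm{Char}$.
   Context: Graphs and lattices. $\Gamma$ is a finite connected plumbing graph (without loops) with vertex set $\mathcal J=\{1,\dots,s\}$; vertex $j$ carries an Euler number $e_j\in\mathbb Z$ and a genus $g_j\ge 0$. $L=\bigoplus_j\mathbb Z E_j$ with form $(E_j,E_j)=e_j$, $(E_i,E_j)=$ number of edges joining $i,j$ ($i\ne j$), assumed negative definite. $L'=\{l'\in L\otimes\mathbb Q:(l',l)\in\mathbb Z\ \forall l\in L\}$. $K\in L'$ is given by $(K,E_j)=-e_j-2+2g_j$ for all $j$; $\mathrm{Char}=K+2L'$. For $k\in\mathrm{Char}$, $\chi_k(l)=-(l,l+k)/2$. $L_e=\{\sum n_jE_j\in L: n_j\ge0\ \forall j\}$. $\Gamma$ is rational if $\min_{l\in L_e\setminus 0}\chi_K(l)>0$ (then automatically all $g_j=0$ and $\Gamma$ is a tree). Weights (for $k\in\mathrm{Char}$). For integers $g,n\ge0$ let $M^g(n)$ be the maximum of $\dim H^1(C,\mathcal L)$ over all compact Riemann surfaces $C$ of genus $g$ and holomorphic line bundles $\mathcal L$ on $C$ with $\chi(\mathcal L)=n$. In the cubical decomposition of $L\otimes\mathbb R=\mathbb R^s$ a $q$-cube is given by $l\in L$ and $I\subset\mathcal J$, $|I|=q$, with vertices $l+\sum_{j\in I'}E_j$, $I'\subset I$ (oriented using the order of indices); $\mathcal Q_q$ is the set of $q$-cubes. $w_0(l)=\chi_k(l)$;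 for $S=[l,l+E_j]$, $w_1(S)=\max\{\chi_k(l),\chi_k(l+E_j)\}+M^{g_j}(|\chi_k(l)-\chi_k(l+E_j)|)$; for $q\ge2$, $w_q(\square_q)=\max\{w_1(S):S\text{ a segment of }\square_q\}$. $m_k=\min_{l\in L}\chi_k(l)$. Lattice cohomology. $\mathcal T_0^+=\mathbb Z[U,U^{-1}]/U\,\mathbb Z[U]$, $\deg U^{-d}=2d$; $\mathcal T_r^+$ is $\mathcal T_0^+$ with degrees shifted up by $r$ (so $\mathcal T_{2m}^+=\mathbb Z\langle U^{-m},U^{-m-1},\dots\rangle$). $\mathcal F^q=\mathrm{Hom}_{\mathbb Z}(\mathcal C_q,\mathcal T_0^+)$, $\mathcal C_q$ free on $\mathcal Q_q$; $\phi\in\mathcal F^q$ is homogeneous of degree $d$ if each nonzero $\phi(\square_q)$ is homogeneous of degree $d-2w(\square_q)$. If $\partial\square_{q+1}=\sum_k\varepsilon_k\square_q^k$, then $(\delta_w\phi)(\square_{q+1})=\sum_k\varepsilon_kU^{w(\square_{q+1})-w(\square_q^k)}\phi(\square_q^k)$. The augmentation $\epsilon_w:\mathcal T^+_{2m_k}\to\mathcal F^0$ sends $U^{-m_k-t}$ ($t\ge0$) to the function $l\mapsto U^{-m_k+w_0(l)-t}\in\mathcal T_0^+$. $\mathbb H^*(\Gamma,k)$ is the cohomology of $(\mathcal F^*,\delta_w)$ and $\mathbb H^*_{red}(\Gamma,k)$ the cohomology of the augmented complex $0\to\mathcal T^+_{2m_k}\xrightarrow{\epsilon_w}\mathcal F^0\to\mathcal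 F^1\to\cdots$; so $\mathbb H^q_{red}=\mathbb H^q$ for $q>0$ and $\mathbb H^0_{red}=\mathbb H^0/\mathrm{im}\,\epsilon_w$. *)

theory Defs
  imports
    "HOL-Analysis.Analysis"
    "HOL-Algebra.Elementary_Groups"
    "HOL-Library.Poly_Mapping"
begin

text \<open>A surface is given by a topology \<open>X\<close> and a holomorphic atlas \<open>A\<close>, a set of pairs
  (open set, coordinate).\<close>

definition complex_chart :: "'a topology \<Rightarrow> 'a set \<times> ('a \<Rightarrow> complex) \<Rightarrow> bool" where
  "complex_chart X = (\<lambda>(U, \<phi>). openin X U \<and> open (\<phi> ` U) \<and>
     homeomorphic_map (subtopology X U) (top_of_set (\<phi> ` U)) \<phi>)"

definition compact_riemann_surface ::
    "'a topology \<Rightarrow> ('a set \<times> ('a \<Rightarrow> complex)) set \<Rightarrow> bool" where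
  "compact_riemann_surface X A \<longleftrightarrow>
     topspace X \<noteq> {} \<and> connected_space X \<and> compact_space X \<and> Hausdorff_space X \<and>
     (\<forall>c\<in>A. complex_chart X c) \<and> (\<Union>c\<in>A. fst c) = topspace X \<and>
     (\<forall>(U, \<phi>)\<in>A. \<forall>(V, \<psi>)\<in>A. (\<psi> \<circ> inv_into U \<phi>) holomorphic_on (\<phi> ` (U \<inter> V)))"

definition holo_fun ::
    "('a set \<times> ('a \<Rightarrow> complex)) set \<Rightarrow> 'a set \<Rightarrow> ('a \<Rightarrow> complex) \<Rightarrow> bool" where
  "holo_fun A W f \<longleftrightarrow> (\<forall>(U, \<phi>)\<in>A. (f \<circ> inv_into U \<phi>) holomorphic_on (\<phi> ` (U \<inter> W)))"

text \<open>A holomorphic line bundle is given by trivializing open sets \<open>U i\<close> and transition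
  functions \<open>g i j\<close>. A section over \<open>W\<close> is a family \<open>s i\<close> of holomorphic functions on
  \<open>W \<inter> U i\<close> with \<open>s i = g i j * s j\<close>.\<close>

definition holo_line_bundle ::
    "'a topology \<Rightarrow> ('a set \<times> ('a \<Rightarrow> complex)) set \<Rightarrow>
     ('i \<Rightarrow> 'a set) \<Rightarrow> ('i \<Rightarrow> 'i \<Rightarrow> 'a \<Rightarrow> complex) \<Rightarrow> bool" where
  "holo_line_bundle X A U g \<longleftrightarrow>
     (\<forall>i. openin X (U i)) \<and> (\<Union>i. U i) = topspace X \<and>
     (\<forall>i j. holo_fun A (U i \<inter> U j) (g i j)) \<and>
     (\<forall>i j. \<forall>p\<in>U i \<inter> U j. g i j p \<noteq> 0) \<and>
     (\<forall>i j k. \<forall>p\<in>U i \<inter> U j \<inter> U k. g i j p * g j k p = g i k p)"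

definition is_section ::
    "('a set \<times> ('a \<Rightarrow> complex)) set \<Rightarrow> ('i \<Rightarrow> 'a set) \<Rightarrow> ('i \<Rightarrow> 'i \<Rightarrow> 'a \<Rightarrow> complex) \<Rightarrow>
     'a set \<Rightarrow> ('i \<Rightarrow> 'a \<Rightarrow> complex) \<Rightarrow> bool" where
  "is_section A U g W s \<longleftrightarrow>
     (\<forall>i. holo_fun A (W \<inter> U i) (s i)) \<and>
     (\<forall>i j. \<forall>p\<in>W \<inter> U i \<inter> U j. s i p = g i j p * s j p)"

text \<open>\<open>quotient_dim Z B n\<close>: for complex vector spaces of functions \<open>B \<subseteq> Z\<close>, the quotient
  \<open>Z / B\<close> has a basis of \<open>n\<close> elements (the classes of \<open>v 0, \<dots>, v (n - 1)\<close>).\<close>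

definition quotient_dim :: "('x \<Rightarrow> complex) set \<Rightarrow> ('x \<Rightarrow> complex) set \<Rightarrow> nat \<Rightarrow> bool" where
  "quotient_dim Z B n \<longleftrightarrow>
     (\<exists>v::nat \<Rightarrow> 'x \<Rightarrow> complex. (\<forall>i<n. v i \<in> Z) \<and>
       (\<forall>f\<in>Z. \<exists>!c::nat \<Rightarrow> complex.
          (\<forall>i\<ge>n. c i = 0) \<and> (\<lambda>x. f x - (\<Sum>i<n. c i * v i x)) \<in> B))"

text \<open>Sections are functions considered only on \<open>W \<inter> U i\<close>, so the global sections are divided by
  the functions vanishing there.\<close>

definition dim_H0 ::
    "'a topology \<Rightarrow> ('a set \<times> ('a \<Rightarrow> complex)) set \<Rightarrow> ('i \<Rightarrow> 'a set) \<Rightarrow>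
     ('i \<Rightarrow> 'i \<Rightarrow> 'a \<Rightarrow> complex) \<Rightarrow> nat \<Rightarrow> bool" where
  "dim_H0 X A U g n \<longleftrightarrow>
     quotient_dim {s. is_section A U g (topspace X) (curry s)} {s. \<forall>i. \<forall>p\<in>U i. s (i, p) = 0} n"

text \<open>First Cech cohomology, i.e. the direct limit over all open covers. Covers of the form
  \<open>(N x)\<close>, indexed by the points \<open>x\<close> of \<open>X\<close> with \<open>x \<in> N x\<close>, are cofinal, and between those the
  refinement maps are the identity on indices. Hence the limit is the quotient of all families that
  are cocycles on some such cover by those that are coboundaries on some such cover; the
  latter include the families that vanish after refinement.\<close>

definition point_covers :: "'a topology \<Rightarrow> ('a \<Rightarrow> 'a set) set" where
  "point_covers X = {N. \<forall>x\<in>topspace X. openin X (N x) \<and> x \<in> N x}"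

definition cech_Z1 ::
    "'a topology \<Rightarrow> ('a set \<times> ('a \<Rightarrow> complex)) set \<Rightarrow> ('i \<Rightarrow> 'a set) \<Rightarrow>
     ('i \<Rightarrow> 'i \<Rightarrow> 'a \<Rightarrow> complex) \<Rightarrow> ('a \<times> 'a \<times> 'i \<times> 'a \<Rightarrow> complex) set" where
  "cech_Z1 X A U g = {f. \<exists>N\<in>point_covers X.
     (\<forall>x\<in>topspace X. \<forall>y\<in>topspace X. is_section A U g (N x \<inter> N y) (\<lambda>i p. f (x, y, i, p))) \<and>
     (\<forall>x\<in>topspace X. \<forall>y\<in>topspace X. \<forall>z\<in>topspace X. \<forall>i. \<forall>p\<in>N x \<inter> N y \<inter> N z \<inter> U i.
        f (x, z, i, p) = f (x, y, i, p) + f (y, z, i, p))}"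

definition cech_B1 ::
    "'a topology \<Rightarrow> ('a set \<times> ('a \<Rightarrow> complex)) set \<Rightarrow> ('i \<Rightarrow> 'a set) \<Rightarrow>
     ('i \<Rightarrow> 'i \<Rightarrow> 'a \<Rightarrow> complex) \<Rightarrow> ('a \<times> 'a \<times> 'i \<times> 'a \<Rightarrow> complex) set" where
  "cech_B1 X A U g = {f. \<exists>N\<in>point_covers X. \<exists>h :: 'a \<Rightarrow> 'i \<Rightarrow> 'a \<Rightarrow> complex.
     (\<forall>x\<in>topspace X. is_section A U g (N x) (h x)) \<and>
     (\<forall>x\<in>topspace X. \<forall>y\<in>topspace X. \<forall>i. \<forall>p\<in>N x \<inter> N y \<inter> U i.
        f (x, y, i, p) = h y i p - h x i p)}"

definition dim_H1 ::
    "'a topology \<Rightarrow> ('a set \<times> ('a \<Rightarrow> complex)) set \<Rightarrow> ('i \<Rightarrow> 'a set) \<Rightarrow>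
     ('i \<Rightarrow> 'i \<Rightarrow> 'a \<Rightarrow> complex) \<Rightarrow> nat \<Rightarrow> bool" where
  "dim_H1 X A U g n \<longleftrightarrow> quotient_dim (cech_Z1 X A U g) (cech_B1 X A U g) n"

text \<open>The genus of a compact Riemann surface is the dimension of the first cohomology of its
  structure sheaf, which is here the sheaf of sections of the trivial bundle.\<close>

definition has_genus :: "'a topology \<Rightarrow> ('a set \<times> ('a \<Rightarrow> complex)) set \<Rightarrow> nat \<Rightarrow> bool" where
  "has_genus X A n \<longleftrightarrow> dim_H1 X A (\<lambda>_::unit. topspace X) (\<lambda>_ _ _. 1) n"

text \<open>The underlying set of a compact Riemann surface has the cardinality of the continuum, so up to
  isomorphism it is a set of complex numbers; by compactness countably many trivializing open sets
  suffice. The supremum is a maximum: the set is nonempty and bounded.\<close>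

definition max_h1 :: "nat \<Rightarrow> nat \<Rightarrow> nat" where
  "max_h1 g n = Sup {h1. \<exists>(X :: complex topology) A (U :: nat \<Rightarrow> complex set) t h0.
     compact_riemann_surface X A \<and> has_genus X A g \<and> holo_line_bundle X A U t \<and>
     dim_H0 X A U t h0 \<and> dim_H1 X A U t h1 \<and> int h0 - int h1 = int n}"

text \<open>\<open>edges G i j\<close> is the number of edges joining \<open>i\<close> and \<open>j\<close>; \<open>eul\<close> and \<open>gen\<close> are
  the Euler numbers and the genera. The vertex set is a nonempty finite
  linearly ordered type.\<close>

record 'v plumbing =
  edges :: "'v \<Rightarrow> 'v \<Rightarrow> nat"
  eul :: "'v \<Rightarrow> int"
  gen :: "'v \<Rightarrow> nat"

definition plumbing_graph :: "'v plumbing \<Rightarrow> bool" where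
  "plumbing_graph G \<longleftrightarrow>
     (\<forall>i j. edges G i j = edges G j i) \<and> (\<forall>i. edges G i i = 0)"

definition connected_graph :: "'v plumbing \<Rightarrow> bool" where
  "connected_graph G \<longleftrightarrow> (\<forall>i j. (i, j) \<in> {(a, b). edges G a b > 0}\<^sup>*)"

text \<open>The lattice \<open>L\<close> is \<open>'v \<Rightarrow> int\<close>, embedded by \<open>rvec\<close> in its rationalization \<open>'v \<Rightarrow> rat\<close>.\<close>

definition rvec :: "('v \<Rightarrow> int) \<Rightarrow> 'v \<Rightarrow> rat" where
  "rvec l = (\<lambda>j. of_int (l j))"

definition basis_vec :: "'v \<Rightarrow> 'v \<Rightarrow> int" where
  "basis_vec j = (\<lambda>i. if i = j then 1 else 0)"

definition inter_form :: "'v::finite plumbing \<Rightarrow> ('v \<Rightarrow> rat) \<Rightarrow> ('v \<Rightarrow> rat) \<Rightarrow> rat" where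
  "inter_form G x y = (\<Sum>i\<in>UNIV. \<Sum>j\<in>UNIV.
     x i * y j * (if i = j then of_int (eul G i) else of_nat (edges G i j)))"

definition negative_definite :: "'v::finite plumbing \<Rightarrow> bool" where
  "negative_definite G \<longleftrightarrow> (\<forall>l::'v \<Rightarrow> int. l \<noteq> (\<lambda>_. 0) \<longrightarrow> inter_form G (rvec l) (rvec l) < 0)"

definition dual_lattice :: "'v::finite plumbing \<Rightarrow> ('v \<Rightarrow> rat) set" where
  "dual_lattice G = {l'. \<forall>l. inter_form G l' (rvec l) \<in> \<int>}"

text \<open>Existence and uniqueness hold since the form is nondegenerate.\<close>

definition canonical_class :: "'v::finite plumbing \<Rightarrow> 'v \<Rightarrow> rat" where
  "canonical_class G = (THE x. \<forall>j.
     inter_form G x (rvec (basis_vec j)) = of_int (- eul G j - 2 + 2 * int (gen G j)))"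

definition characteristic :: "'v::finite plumbing \<Rightarrow> ('v \<Rightarrow> rat) set" where
  "characteristic G = {k. \<exists>l'\<in>dual_lattice G. k = (\<lambda>j. canonical_class G j + 2 * l' j)}"

text \<open>For \<open>k \<in> characteristic G\<close> the number under the floor is an integer.\<close>

definition chi :: "'v::finite plumbing \<Rightarrow> ('v \<Rightarrow> rat) \<Rightarrow> ('v \<Rightarrow> int) \<Rightarrow> int" where
  "chi G k l = \<lfloor>- inter_form G (rvec l) (\<lambda>j. rvec l j + k j) / 2\<rfloor>"

definition effective :: "('v \<Rightarrow> int) set" where
  "effective = {l. \<forall>j. 0 \<le> l j}"

text \<open>\<open>Inf\<close> on \<^typ>\<open>int\<close> is the minimum of a nonempty set that is bounded below.\<close>

definition rational_graph :: "'v::finite plumbing \<Rightarrow> bool" where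
  "rational_graph G \<longleftrightarrow> 0 < Inf (chi G (canonical_class G) ` (effective - {\<lambda>_. 0}))"

definition m_min :: "'v::finite plumbing \<Rightarrow> ('v \<Rightarrow> rat) \<Rightarrow> int" where
  "m_min G k = Inf (range (chi G k))"

text \<open>\<open>shift l I\<close> is the sum of \<open>l\<close> and the \<open>basis_vec j\<close> for \<open>j \<in> I\<close>.\<close>

definition shift :: "('v \<Rightarrow> int) \<Rightarrow> 'v set \<Rightarrow> 'v \<Rightarrow> int" where
  "shift l I = (\<lambda>j. if j \<in> I then l j + 1 else l j)"

type_synonym 'v cube = "('v \<Rightarrow> int) \<times> 'v set"

definition cubes :: "nat \<Rightarrow> 'v::finite cube set" where
  "cubes q = {(l, I). card I = q}"

definition weight1 :: "'v::finite plumbing \<Rightarrow> ('v \<Rightarrow> rat) \<Rightarrow> ('v \<Rightarrow> int) \<Rightarrow> 'v \<Rightarrow> int" where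
  "weight1 G k l j = max (chi G k l) (chi G k (shift l {j})) +
     int (max_h1 (gen G j) (nat \<bar>chi G k l - chi G k (shift l {j})\<bar>))"

text \<open>The segments of the cube \<open>(l, I)\<close> start at \<open>shift l I'\<close> in direction \<open>j \<in> I - I'\<close>; for a
  1-cube there is just one.\<close>

definition weight :: "'v::finite plumbing \<Rightarrow> ('v \<Rightarrow> rat) \<Rightarrow> 'v cube \<Rightarrow> int" where
  "weight G k = (\<lambda>(l, I). if I = {} then chi G k l
     else Max {weight1 G k (shift l I') j |j I'. j \<in> I \<and> I' \<subseteq> I - {j}})"

text \<open>The module \<open>\<T>\<^sub>0\<^sup>+\<close> is free over the integers on \<open>U\<^sup>-\<^sup>d\<close>, \<open>d \<ge> 0\<close>; an element is represented by
  its coefficients as a function of \<open>d\<close>. Multiplication by \<open>U\<^sup>n\<close> sends \<open>U\<^sup>-\<^sup>d\<close> to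
  \<open>U\<^sup>-\<^sup>(\<^sup>d\<^sup>-\<^sup>n\<^sup>)\<close>, or to 0 if \<open>d < n\<close>.\<close>

type_synonym tplus = "nat \<Rightarrow>\<^sub>0 int"

definition Upow :: "nat \<Rightarrow> tplus \<Rightarrow> tplus" where
  "Upow n t = Poly_Mapping.map_key (\<lambda>d. d + n) t"

text \<open>A homomorphism from the free group on the \<open>q\<close>-cubes is given by its values on these cubes, and
  is extended by 0 to all other cubes.\<close>

type_synonym 'v cochain = "'v cube \<Rightarrow> tplus"

definition cochain_group :: "nat \<Rightarrow> 'v::finite cochain monoid" where
  "cochain_group q = \<lparr>carrier = {\<phi>. \<forall>c. c \<notin> cubes q \<longrightarrow> \<phi> c = 0},
     mult = (\<lambda>\<phi> \<psi> c. \<phi> c + \<psi> c), one = (\<lambda>_. 0)\<rparr>"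

text \<open>The boundary of \<open>(l, I)\<close> is the sum over \<open>i \<in> I\<close> of the far face \<open>(shift l {i}, I - {i})\<close> minus the
  near face \<open>(l, I - {i})\<close>, with sign given by the position of \<open>i\<close> in \<open>I\<close>.\<close>

definition delta :: "'v::{finite,linorder} plumbing \<Rightarrow> ('v \<Rightarrow> rat) \<Rightarrow> nat \<Rightarrow>
    'v cochain \<Rightarrow> 'v cochain" where
  "delta G k q \<phi> = (\<lambda>(l, I). if (l, I) \<in> cubes (Suc q) then
     (\<Sum>i\<in>I. let far = (shift l {i}, I - {i}); near = (l, I - {i});
                 d = Upow (nat (weight G k (l, I) - weight G k far)) (\<phi> far) -
                     Upow (nat (weight G k (l, I) - weight G k near)) (\<phi> near)
             in if even (card {j\<in>I. j < i}) then d else - d)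
     else 0)"

text \<open>The coefficient of an element of \<open>\<T>\<^sup>+\<close> shifted to lowest degree \<open>2 m\<close>, \<open>m = m_min G k\<close>, at
  \<open>U\<^sup>-\<^sup>m\<^sup>-\<^sup>t\<close> is recorded at \<open>t\<close>; its image at the vertex \<open>l\<close> is then the product with
  \<open>U\<close> to the power \<open>chi G k l - m\<close>.\<close>

definition augmentation :: "'v::finite plumbing \<Rightarrow> ('v \<Rightarrow> rat) \<Rightarrow> tplus \<Rightarrow> 'v cochain" where
  "augmentation G k t = (\<lambda>(l, I). if (l, I) \<in> cubes 0
     then Upow (nat (weight G k (l, I) - m_min G k)) t else 0)"

definition cocycles :: "'v::{finite,linorder} plumbing \<Rightarrow> ('v \<Rightarrow> rat) \<Rightarrow> nat \<Rightarrow>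
    'v cochain set" where
  "cocycles G k q = {\<phi> \<in> carrier (cochain_group q). delta G k q \<phi> = (\<lambda>_. 0)}"

primrec reduced_coboundaries :: "'v::{finite,linorder} plumbing \<Rightarrow> ('v \<Rightarrow> rat) \<Rightarrow> nat \<Rightarrow>
    'v cochain set" where
  "reduced_coboundaries G k 0 = range (augmentation G k)"
| "reduced_coboundaries G k (Suc q) = delta G k q ` carrier (cochain_group q)"

definition reduced_lattice_cohomology :: "'v::{finite,linorder} plumbing \<Rightarrow> ('v \<Rightarrow> rat) \<Rightarrow> nat \<Rightarrow>
    'v cochain set monoid" where
  "reduced_lattice_cohomology G k q =
     (cochain_group q\<lparr>carrier := cocycles G k q\<rparr>) Mod reduced_coboundaries G k q"

end

theory Submission
  imports Defs "HOL-Complex_Analysis.Conformal_Mappings"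
begin

text \<open>Rationality enters through one inequality: for every \<open>l > 0\<close> in the lattice there is \<open>j\<close> in the
  support of \<open>l\<close> with \<open>(l + K, E\<^sub>j) < 0\<close>, because otherwise \<open>\<chi>\<^sub>K(l) \<le> 0\<close> (\<open>rational_direction\<close>). Let now \<open>k\<close> be
  any characteristic element and \<open>\<chi> = \<chi>\<^sub>k\<close>. Applied to the diagonal \<open>l = b - a\<close> of a box \<open>[a, b]\<close>, the
  inequality says that for some \<open>j\<close> with \<open>a\<^sub>j < b\<^sub>j\<close> either \<open>\<chi>(a + E\<^sub>j) \<le> \<chi>(a)\<close> or \<open>\<chi>(b - E\<^sub>j) \<le> \<chi>(b)\<close>.
  Since \<open>(E\<^sub>i, E\<^sub>j) \<ge> 0\<close> for \<open>i \<noteq> j\<close>, the same inequality then holds on the whole face of the box through that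
  corner and orthogonal to \<open>E\<^sub>j\<close>. So this face can be pushed one step into the box without increasing \<open>\<chi>\<close>.
  Repeating this, each box collapses to a point (\<open>collapse_box_to_point\<close>).

  By negative definiteness there is \<open>Z\<close> with \<open>(Z, E\<^sub>j) < 0\<close> for all \<open>j\<close>, and the boxes \<open>[- n Z, n Z]\<close> exhaust the
  lattice. For large \<open>n\<close> the same pushing, without any use of rationality, collapses each of them to the
  preceding one (\<open>exists_exhaustion\<close>). In particular \<open>\<chi>\<close> is bounded below.

  Rationality also makes all genera zero. In genus 0 the numbers \<open>M\<close> vanish (\<open>max_h1_genus_0\<close>): a line bundle
  with \<open>h\<^sup>0 \<ge> h\<^sup>1 > 0\<close> has a nonzero section, and division by this section shows that its first cohomology is a
  quotient of that of the structure sheaf, which is zero. Hence the weight of a cube is the maximum of \<open>\<chi>\<close>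
  over its vertices (\<open>weight_eq_Max\<close>), and pushing a cube of the face into the box sweeps out a prism of the
  same weight as the cube. The coboundary on this prism can therefore be solved for the value on the cube, with
  coefficient \<open>U\<^sup>0\<close>. Thus a primitive of a cocycle extends along each collapse, from a point to a box and from
  each box of the exhaustion to the next (\<open>extend_collapse\<close>), and a cocycle of degree 0 is determined by its
  value at the point to which everything collapses, a minimum of \<open>\<chi>\<close>; it is the augmentation of that value.\<close>

section \<open>Coefficients, signs and sets of cubes\<close>

lemma lookup_Upow [simp]: "Poly_Mapping.lookup (Upow n t) d = Poly_Mapping.lookup t (d + n)"
  unfolding Upow_def by (subst map_key.rep_eq) (auto simp: inj_def)

lemma Upow_0 [simp]: "Upow 0 t = t"
  by (rule poly_mapping_eqI) simp

lemma Upow_zero [simp]: "Upow n 0 = 0"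
  by (rule poly_mapping_eqI) simp

lemma Upow_add: "Upow n (s + t) = Upow n s + Upow n t"
  by (rule poly_mapping_eqI) (simp add: lookup_add)

lemma Upow_diff: "Upow n (s - t) = Upow n s - Upow n t"
  by (rule poly_mapping_eqI) (simp add: lookup_minus)

lemma Upow_uminus: "Upow n (- t) = - Upow n t"
  by (rule poly_mapping_eqI) simp

lemma Upow_Upow: "Upow m (Upow n t) = Upow (m + n) t"
  by (rule poly_mapping_eqI) (simp add: add.assoc)

lemma Upow_sum: "Upow n (sum f A) = (\<Sum>a\<in>A. Upow n (f a))"
  by (induction A rule: infinite_finite_induct) (auto simp: Upow_add)

lemma tplus_eq_uminus_imp_zero:
  fixes t :: tplus
  assumes "t = - t"
  shows "t = 0"
proof (rule poly_mapping_eqI)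
  fix d
  have "Poly_Mapping.lookup t d = - Poly_Mapping.lookup t d"
    by (metis assms lookup_uminus)
  then show "Poly_Mapping.lookup t d = Poly_Mapping.lookup 0 d" by simp
qed

lemma shift_empty [simp]: "shift l {} = l"
  by (simp add: shift_def)

lemma shift_shift: "I \<inter> J = {} \<Longrightarrow> shift (shift l I) J = shift l (I \<union> J)"
  by (auto simp: shift_def fun_eq_iff)

text \<open>The sign in the boundary of the cube \<open>(l, I)\<close> of its two faces orthogonal to \<open>i\<close>, as an
  operation on coefficients: the exponent is the position of \<open>i\<close> in \<open>I\<close>.\<close>

definition face_sign :: "'v::linorder \<Rightarrow> 'v set \<Rightarrow> tplus \<Rightarrow> tplus" where
  "face_sign i I t = (if even (card {j\<in>I. j < i}) then t else - t)"

lemma face_sign_simps [simp]: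
  "face_sign i I 0 = 0"
  "face_sign i I (face_sign i I t) = t"
  "Upow n (face_sign i I t) = face_sign i I (Upow n t)"
  "face_sign i I (s + t) = face_sign i I s + face_sign i I t"
  "face_sign i I (s - t) = face_sign i I s - face_sign i I t"
  "face_sign i I (- t) = - face_sign i I t"
  by (auto simp: face_sign_def Upow_uminus)

lemma face_sign_sum: "face_sign i I (sum f A) = (\<Sum>a\<in>A. face_sign i I (f a))"
  by (auto simp: face_sign_def sum_negf)

lemma face_sign_eq_0_iff [simp]: "face_sign i I t = 0 \<longleftrightarrow> t = 0"
  by (auto simp: face_sign_def)

lemma face_sign_swap_if_less:
  fixes i j :: "'v::{finite,linorder}"
  assumes "i \<in> I" "j \<in> I" "i < j"
  shows "face_sign i I (face_sign j (I - {i}) t) = - face_sign j I (face_sign i (I - {j}) t)"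
proof -
  have "{a\<in>I - {j}. a < i} = {a\<in>I. a < i}" using assms by auto
  moreover have "{a\<in>I. a < j} = insert i {a\<in>I - {i}. a < j}" using assms by auto
  then have "card {a\<in>I. a < j} = Suc (card {a\<in>I - {i}. a < j})" by simp
  ultimately show ?thesis by (simp add: face_sign_def)
qed

text \<open>Removing two directions from a cube in the two possible orders gives opposite signs; this is what
  makes the square of the coboundary vanish.\<close>

lemma face_sign_swap:
  fixes i j :: "'v::{finite,linorder}"
  assumes "i \<in> I" "j \<in> I" "i \<noteq> j"
  shows "face_sign i I (face_sign j (I - {i}) t) = - face_sign j I (face_sign i (I - {j}) t)"
  using face_sign_swap_if_less[of i I j t] face_sign_swap_if_less[of j I i t] assms
  by (cases i j rule: linorder_cases) auto

text \<open>The cubes all of whose vertices lie in \<open>R\<close>.\<close>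

definition cubes_in :: "('v \<Rightarrow> int) set \<Rightarrow> 'v cube set" where
  "cubes_in R = {(l, I). \<forall>J\<subseteq>I. shift l J \<in> R}"

lemma cubes_in_faces:
  assumes "(l, I) \<in> cubes_in R" "i \<in> I"
  shows "(shift l {i}, I - {i}) \<in> cubes_in R" "(l, I - {i}) \<in> cubes_in R"
proof -
  show "(l, I - {i}) \<in> cubes_in R" using assms by (auto simp: cubes_in_def)
  have "shift (shift l {i}) J \<in> R" if "J \<subseteq> I - {i}" for J
  proof -
    have "shift (shift l {i}) J = shift l ({i} \<union> J)" using that by (intro shift_shift) auto
    moreover have "{i} \<union> J \<subseteq> I" using that assms by auto
    ultimately show ?thesis using assms by (auto simp: cubes_in_def)
  qed
  then show "(shift l {i}, I - {i}) \<in> cubes_in R" by (auto simp: cubes_in_def)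
qed

section \<open>Collapses and the cohomology of the maximum weight\<close>

text \<open>The points of \<open>R\<close> whose \<open>j\<close>-th coordinate is \<open>c\<close> form a collapsible slice of \<open>R\<close>: all of \<open>R\<close> lies
  on one side of the slice (the upper side if \<open>d = 1\<close>, the lower side if \<open>d = - 1\<close>), and translating the
  slice by one step towards that side leads into \<open>R\<close> and does not increase \<open>f\<close>. The relation
  \<open>collapses_to f\<close> removes such a slice. On every sublevel set of \<open>f\<close>, understood as a union of cubes,
  it is a deformation retraction.\<close>

definition collapse :: "(('v \<Rightarrow> int) \<Rightarrow> int) \<Rightarrow> 'v \<Rightarrow> int \<Rightarrow> int \<Rightarrow> ('v \<Rightarrow> int) set \<Rightarrow> bool" where
  "collapse f j c d R \<longleftrightarrow> (d = 1 \<or> d = - 1) \<and> (\<forall>x\<in>R. 0 \<le> d * (x j - c)) \<and>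
     (\<forall>x\<in>R. x j = c \<longrightarrow> x(j := c + d) \<in> R \<and> f (x(j := c + d)) \<le> f x)"

definition collapses_to :: "(('v \<Rightarrow> int) \<Rightarrow> int) \<Rightarrow> ('v \<Rightarrow> int) set \<Rightarrow> ('v \<Rightarrow> int) set \<Rightarrow> bool" where
  "collapses_to f R S \<longleftrightarrow> (\<exists>j c d. collapse f j c d R \<and> S = {x\<in>R. x j \<noteq> c})"

lemma collapses_subset: "(collapses_to f)\<^sup>*\<^sup>* R S \<Longrightarrow> S \<subseteq> R"
  by (induction rule: rtranclp_induct) (auto simp: collapses_to_def)

lemma collapses_below:
  assumes "(collapses_to f)\<^sup>*\<^sup>* R S" "x \<in> R"
  shows "\<exists>y\<in>S. f y \<le> f x"
  using assms
proof (induction rule: rtranclp_induct)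
  case base
  then show ?case by blast
next
  case (step S T)
  then obtain y where y: "y \<in> S" "f y \<le> f x" by blast
  obtain j c d where c: "collapse f j c d S" "T = {x\<in>S. x j \<noteq> c}"
    using step by (auto simp: collapses_to_def)
  show ?case
  proof (cases "y j = c")
    case True
    then have "y(j := c + d) \<in> S" "f (y(j := c + d)) \<le> f y" "d \<noteq> 0"
      using c y by (auto simp: collapse_def)
    then have "y(j := c + d) \<in> T" "f (y(j := c + d)) \<le> f x" using c y by simp_all
    then show ?thesis by blast
  next
    case False
    then show ?thesis using y c by auto
  qed
qed

text \<open>When all correction terms \<open>M\<close> vanish, the weight of a cube is the maximum of \<open>\<chi>\<close> over its vertices. The
  statements in this locale depend on the plumbing graph only through this property.\<close>

locale max_weight =
  fixes G :: "'v::{finite,linorder} plumbing" and k :: "'v \<Rightarrow> rat"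
  assumes weight_eq: "weight G k (l, I) = Max ((\<lambda>J. chi G k (shift l J)) ` Pow I)"
begin

lemma weight_ge: "J \<subseteq> I \<Longrightarrow> chi G k (shift l J) \<le> weight G k (l, I)"
  unfolding weight_eq by (rule Max_ge) auto

lemma weight_le_iff: "weight G k (l, I) \<le> n \<longleftrightarrow> (\<forall>J\<subseteq>I. chi G k (shift l J) \<le> n)"
  unfolding weight_eq by (subst Max_le_iff) auto

lemma weight_near: "weight G k (l, I - {i}) \<le> weight G k (l, I)"
  unfolding weight_le_iff by (auto intro: weight_ge)

lemma weight_far:
  assumes "i \<in> I"
  shows "weight G k (shift l {i}, I - {i}) \<le> weight G k (l, I)"
  unfolding weight_le_iff
proof (intro allI impI)
  fix J assume "J \<subseteq> I - {i}"
  then have "shift (shift l {i}) J = shift l ({i} \<union> J)" by (intro shift_shift) auto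
  then show "chi G k (shift (shift l {i}) J) \<le> weight G k (l, I)"
    using \<open>J \<subseteq> I - {i}\<close> assms by (simp only:) (rule weight_ge, auto)
qed

lemma delta_eq:
  assumes "card I = Suc q"
  shows "delta G k q \<phi> (l, I) = (\<Sum>i\<in>I. face_sign i I
     (Upow (nat (weight G k (l, I) - weight G k (shift l {i}, I - {i}))) (\<phi> (shift l {i}, I - {i})) -
      Upow (nat (weight G k (l, I) - weight G k (l, I - {i}))) (\<phi> (l, I - {i}))))"
  using assms by (simp add: delta_def cubes_def Let_def face_sign_def)

lemma delta_outside: "card I \<noteq> Suc q \<Longrightarrow> delta G k q \<phi> (l, I) = 0"
  by (simp add: delta_def cubes_def)

lemma delta_diff: "delta G k q (\<lambda>c. \<phi> c - \<psi> c) c = delta G k q \<phi> c - delta G k q \<psi> c"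
proof (cases c)
  case (Pair l I)
  show ?thesis
  proof (cases "card I = Suc q")
    case True
    show ?thesis
      unfolding Pair delta_eq[OF True] sum_subtractf[symmetric]
      by (intro sum.cong refl) (simp add: Upow_diff)
  qed (simp add: Pair delta_outside)
qed

lemma delta_delta: "delta G k (Suc q) (delta G k q \<phi>) c = 0"
proof (cases c)
  case (Pair l I)
  show ?thesis
  proof (cases "card I = Suc (Suc q)")
    case False
    then show ?thesis by (simp add: Pair delta_outside)
  next
    case cI: True
    define V where "V c = Upow (nat (weight G k (l, I) - weight G k c)) (\<phi> c)" for c
    define T where "T i j = V (shift (shift l {i}) {j}, I - {i} - {j}) - V (shift l {i}, I - {i} - {j})
        - V (shift l {j}, I - {i} - {j}) + V (l, I - {i} - {j})" for i j
    have UV: "Upow (nat (weight G k (l, I) - w)) (Upow (nat (w - weight G k c)) (\<phi> c)) = V c"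
      if "w \<le> weight G k (l, I)" "weight G k c \<le> w" for w c
      using that unfolding V_def Upow_Upow by (auto intro!: arg_cong[of _ _ "\<lambda>n. Upow n (\<phi> c)"])
    have T_sym: "T i j = T j i" for i j
    proof -
      have "shift (shift l {i}) {j} = shift (shift l {j}) {i}"
        by (auto simp: shift_def fun_eq_iff)
      moreover have "I - {i} - {j} = I - {j} - {i}" by auto
      ultimately show ?thesis by (simp add: T_def algebra_simps)
    qed
    have inner: "Upow (nat (weight G k (l, I) - weight G k (shift l {i}, I - {i})))
          (delta G k q \<phi> (shift l {i}, I - {i})) -
        Upow (nat (weight G k (l, I) - weight G k (l, I - {i}))) (delta G k q \<phi> (l, I - {i})) =
        (\<Sum>j\<in>I - {i}. face_sign j (I - {i}) (T i j))" if "i \<in> I" for i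
    proof -
      have card: "card (I - {i}) = Suc q" using cI that by simp
      have "Upow (nat (weight G k (l, I) - weight G k (shift l {i}, I - {i})))
          (delta G k q \<phi> (shift l {i}, I - {i})) = (\<Sum>j\<in>I - {i}. face_sign j (I - {i})
            (V (shift (shift l {i}) {j}, I - {i} - {j}) - V (shift l {i}, I - {i} - {j})))"
        unfolding delta_eq[OF card] Upow_sum using that
        by (intro sum.cong refl) (simp add: Upow_diff UV weight_far weight_near)
      moreover have "Upow (nat (weight G k (l, I) - weight G k (l, I - {i})))
          (delta G k q \<phi> (l, I - {i})) = (\<Sum>j\<in>I - {i}. face_sign j (I - {i})
            (V (shift l {j}, I - {i} - {j}) - V (l, I - {i} - {j})))"
        unfolding delta_eq[OF card] Upow_sum using that
        by (intro sum.cong refl) (simp add: Upow_diff UV weight_far weight_near)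
      ultimately show ?thesis
        by (simp only: sum_subtractf[symmetric])
           (intro sum.cong refl, simp add: T_def algebra_simps)
    qed
    define F where "F i j = face_sign i I (face_sign j (I - {i}) (T i j))" for i j
    have F: "F i j = - F j i" if "i \<in> I" "j \<in> I" "i \<noteq> j" for i j
      unfolding F_def T_sym[of j i] by (rule face_sign_swap[OF that])
    let ?S = "\<Sum>i\<in>I. \<Sum>j\<in>I. if i = j then 0 else F i j"
    have "delta G k (Suc q) (delta G k q \<phi>) (l, I) = (\<Sum>i\<in>I. \<Sum>j\<in>I - {i}. F i j)"
      unfolding delta_eq[OF cI] by (intro sum.cong refl) (simp add: inner F_def face_sign_sum)
    also have "\<dots> = ?S"
      by (intro sum.cong refl sum.mono_neutral_cong_left) auto
    finally have eq: "delta G k (Suc q) (delta G k q \<phi>) (l, I) = ?S" .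
    have "?S = (\<Sum>j\<in>I. \<Sum>i\<in>I. if i = j then 0 else F i j)" by (rule sum.swap)
    also have "\<dots> = (\<Sum>j\<in>I. \<Sum>i\<in>I. - (if j = i then 0 else F j i))"
      by (intro sum.cong refl) (auto intro: F)
    also have "\<dots> = - ?S" by (simp add: sum_negf)
    finally have "?S = 0" by (rule tplus_eq_uminus_imp_zero)
    then show ?thesis using eq Pair by simp
  qed
qed

text \<open>The translation of a slice cube \<open>(x, I)\<close> by one step sweeps out a prism \<open>(b, insert j I)\<close> of \<open>R\<close>. As \<open>\<chi>\<close>
  does not increase along the translation, the prism has the same weight as the slice cube, so in its
  coboundary the coefficient at the slice cube is multiplied by \<open>U\<^sup>0\<close>.\<close>

lemma prism:
  assumes "collapse (chi G k) j c d R" "(x, I) \<in> cubes_in R" "j \<notin> I" "x j = c"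
  defines "b \<equiv> x(j := min c (c + d))"
  shows "(b, insert j I) \<in> cubes_in R" (is ?thesis1)
    "weight G k (b, insert j I) = weight G k (x, I)" (is ?thesis2)
    "(x(j := c + d), I) \<in> cubes_in R" (is ?thesis3)
    "d = 1 \<Longrightarrow> b = x \<and> shift b {j} = x(j := c + d)"
    "d = - 1 \<Longrightarrow> shift b {j} = x \<and> b = x(j := c + d)"
proof -
  have d: "d = 1 \<or> d = - 1" using assms by (auto simp: collapse_def)
  show e1: "d = 1 \<Longrightarrow> b = x \<and> shift b {j} = x(j := c + d)"
    and e2: "d = - 1 \<Longrightarrow> shift b {j} = x \<and> b = x(j := c + d)"
    using assms by (auto simp: shift_def fun_eq_iff)
  have x: "shift x J \<in> R \<and> shift x J j = c" if "J \<subseteq> I" for J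
    using assms that by (auto simp: cubes_in_def shift_def)
  have n: "shift (x(j := c + d)) J = (shift x J)(j := c + d)" if "J \<subseteq> I" for J
    using assms that by (auto simp: shift_def fun_eq_iff)
  have inR: "shift (x(j := c + d)) J \<in> R \<and> chi G k (shift (x(j := c + d)) J) \<le> weight G k (x, I)"
    if "J \<subseteq> I" for J
  proof -
    have "(shift x J)(j := c + d) \<in> R \<and> chi G k ((shift x J)(j := c + d)) \<le> chi G k (shift x J)"
      using x[OF that] assms by (auto simp: collapse_def)
    then show ?thesis using n[OF that] weight_ge[OF that, of x] by auto
  qed
  then show ?thesis3 by (auto simp: cubes_in_def)
  \<comment> \<open>every vertex of the prism lies on one of the two faces in direction \<open>j\<close>\<close>
  have vertex: "shift b J = shift x (J - {j}) \<or> shift b J = shift (x(j := c + d)) (J - {j})"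
    if "J \<subseteq> insert j I" for J
  proof -
    have "J - {j} \<subseteq> I" using that by auto
    have "shift b J = (if j \<in> J then shift (shift b {j}) (J - {j}) else shift b (J - {j}))"
      by (auto simp: shift_def fun_eq_iff)
    moreover have "b \<in> {x, x(j := c + d)}" "shift b {j} \<in> {x, x(j := c + d)}"
      using d e1 e2 by blast+
    ultimately show ?thesis by (metis insertE singletonD)
  qed
  have *: "shift b J \<in> R \<and> chi G k (shift b J) \<le> weight G k (x, I)" if "J \<subseteq> insert j I" for J
  proof -
    have "J - {j} \<subseteq> I" using that by auto
    then show ?thesis
      using vertex[OF that] inR[of "J - {j}"] x[of "J - {j}"] weight_ge[of "J - {j}" I x] by metis
  qed
  then show ?thesis1 by (auto simp: cubes_in_def)
  have "weight G k (x, I) \<le> weight G k (b, insert j I)"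
  proof -
    have "insert j I - {j} = I" using assms(3) by auto
    moreover have "x = b \<or> x = shift b {j}" using d e1 e2 by blast
    ultimately show ?thesis
      using weight_near[of b "insert j I" j] weight_far[of j "insert j I" b] by auto
  qed
  moreover have "weight G k (b, insert j I) \<le> weight G k (x, I)"
    unfolding weight_le_iff using * by auto
  ultimately show ?thesis2 by simp
qed

text \<open>A cocycle on \<open>R\<close> is determined by its values on the cubes that are not contained in the slice: the
  coboundary of a prism expresses its value on the slice cube by the values on the other faces.\<close>

lemma vanish_on_slice:
  assumes col: "collapse (chi G k) j c d R"
    and cocycle: "\<And>c. delta G k q \<theta> c = 0"
    and zero: "\<And>l I. (l, I) \<in> cubes_in R \<Longrightarrow> card I = q \<Longrightarrow> j \<in> I \<or> l j \<noteq> c \<Longrightarrow> \<theta> (l, I) = 0"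
    and xI: "(x, I) \<in> cubes_in R" "card I = q"
  shows "\<theta> (x, I) = 0"
proof (cases "j \<in> I \<or> x j \<noteq> c")
  case True
  then show ?thesis using zero xI by auto
next
  case False
  define b where "b = x(j := min c (c + d))"
  note p = prism[OF col xI(1), folded b_def]
  have d: "d = 1 \<or> d = - 1" using col by (auto simp: collapse_def)
  have jI: "j \<notin> I" "x j = c" using False by auto
  define J where "J = insert j I"
  have J: "card J = Suc q" "J - {j} = I" "j \<in> J" using jI xI by (auto simp: J_def)
  have bJ: "(b, J) \<in> cubes_in R" using p jI by (simp add: J_def)
  define D where "D i = face_sign i J
     (Upow (nat (weight G k (b, J) - weight G k (shift b {i}, J - {i}))) (\<theta> (shift b {i}, J - {i})) -
      Upow (nat (weight G k (b, J) - weight G k (b, J - {i}))) (\<theta> (b, J - {i})))" for i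
  have "D i = 0" if "i \<in> J - {j}" for i
  proof -
    have "card (J - {i}) = q" "j \<in> J - {i}" using that J by auto
    then show ?thesis
      using zero cubes_in_faces[OF bJ, of i] that by (simp add: D_def)
  qed
  then have "(\<Sum>i\<in>J. D i) = D j" using J by (subst sum.remove[of J j]) auto
  moreover have "(\<Sum>i\<in>J. D i) = 0" using cocycle[of "(b, J)"] unfolding delta_eq[OF J(1)] D_def .
  ultimately have Dj: "D j = 0" by simp
  have inner: "\<theta> (x(j := c + d), I) = 0" using zero p(3) jI xI d by auto
  have w: "weight G k (b, J) = weight G k (x, I)" using p(2) jI by (simp add: J_def)
  show ?thesis
    using d
  proof
    assume "d = 1"
    then have "b = x" "shift b {j} = x(j := c + d)" using p(4) jI by auto
    then show ?thesis using Dj inner w J(2) by (simp add: D_def)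
  next
    assume "d = - 1"
    then have "shift b {j} = x" "b = x(j := c + d)" using p(5) jI by auto
    then show ?thesis using Dj inner w J(2) by (simp add: D_def)
  qed
qed

text \<open>A primitive of a cocycle extends from the smaller set to the larger one: it can be chosen to be zero
  on the prisms, and then the equation on each prism prescribes the value on the slice cube.\<close>

lemma extend_collapse:
  assumes step: "collapses_to (chi G k) R S"
    and cocycle: "\<And>c. delta G k (Suc q) \<phi> c = 0"
    and S: "\<And>l I. (l, I) \<in> cubes_in S \<Longrightarrow> card I = Suc q \<Longrightarrow> delta G k q \<psi> (l, I) = \<phi> (l, I)"
  shows "\<exists>\<psi>'. (\<forall>c\<in>cubes_in S. \<psi>' c = \<psi> c) \<and>
    (\<forall>(l, I)\<in>cubes_in R. card I = Suc q \<longrightarrow> delta G k q \<psi>' (l, I) = \<phi> (l, I))"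
proof -
  obtain j c d where col: "collapse (chi G k) j c d R" and S_eq: "S = {x\<in>R. x j \<noteq> c}"
    using step by (auto simp: collapses_to_def)
  have d: "d = 1 \<or> d = - 1" using col by (auto simp: collapse_def)
  \<comment> \<open>the slice is the near face of the prism if \<open>d = 1\<close> and the far face if \<open>d = - 1\<close>, hence the two signs\<close>
  define \<psi>' where "\<psi>' = (\<lambda>(x, I).
    if j \<notin> I \<and> x j = c \<and> (x, I) \<in> cubes_in R then
      Upow (nat (weight G k (x, I) - weight G k (x(j := c + d), I))) (\<psi> (x(j := c + d), I)) +
      (if d = 1 then - face_sign j (insert j I) (\<phi> (x(j := min c (c + d)), insert j I))
       else face_sign j (insert j I) (\<phi> (x(j := min c (c + d)), insert j I)))
    else if (x, I) \<in> cubes_in S then \<psi> (x, I) else 0)"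
  have agree: "\<psi>' c = \<psi> c" if "c \<in> cubes_in S" for c
    using that by (auto simp: \<psi>'_def S_eq cubes_in_def split: prod.splits)
  have on_S: "delta G k q \<psi>' (l, I) = \<phi> (l, I)" if "(l, I) \<in> cubes_in S" "card I = Suc q" for l I
  proof -
    have "delta G k q \<psi>' (l, I) = delta G k q \<psi> (l, I)"
      unfolding delta_eq[OF that(2)]
      by (intro sum.cong refl) (simp add: agree cubes_in_faces[OF that(1)])
    then show ?thesis using S that by simp
  qed
  have on_prism: "delta G k q \<psi>' (l, J) = \<phi> (l, J)"
    if "(l, J) \<in> cubes_in R" "card J = Suc q" "j \<in> J" "(l, J) \<notin> cubes_in S" for l J
  proof -
    define x where "x = l(j := c)"
    define I where "I = J - {j}"
    have I: "j \<notin> I" "insert j I = J" "J - {j} = I" using that by (auto simp: I_def)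
    have xj: "x j = c" by (simp add: x_def)
    have lR: "l \<in> R" "shift l {j} \<in> R" using that(1,3) by (auto simp: cubes_in_def dest: spec[of _ "{}"])
    have "l j = c \<or> l j = c - 1"
      using that(1,4) by (auto simp: cubes_in_def S_eq shift_def split: if_splits)
    moreover have "0 \<le> d * (l j - c)" "0 \<le> d * (l j + 1 - c)"
      using col lR unfolding collapse_def by (blast, force simp: shift_def)
    ultimately have lj: "l j = min c (c + d)" using d by auto
    then have b: "x(j := min c (c + d)) = l" by (auto simp: x_def fun_eq_iff)
    have x_cases: "x = l \<or> x = shift l {j}"
      using d lj by (auto simp: x_def shift_def fun_eq_iff)
    then have xI: "(x, I) \<in> cubes_in R"
      using cubes_in_faces[OF that(1,3)] by (auto simp: I_def)
    note p = prism[OF col xI I(1) xj, unfolded b I(2)]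
    have no_S: "\<psi>' (y, J - {i}) = 0" if "i \<in> I" "y = l \<or> y = shift l {i}" for y i
    proof -
      have "shift y {} \<notin> S \<or> shift y {j} \<notin> S"
        using that x_cases I xj
        by (auto simp: S_eq shift_def x_def fun_eq_iff split: if_splits)
      moreover have "{} \<subseteq> J - {i}" "{j} \<subseteq> J - {i}" using that I \<open>j \<in> J\<close> by auto
      ultimately have "(y, J - {i}) \<notin> cubes_in S" unfolding cubes_in_def by blast
      then show ?thesis using that I \<open>j \<in> J\<close> by (auto simp: \<psi>'_def)
    qed
    define D where "D i = face_sign i J
     (Upow (nat (weight G k (l, J) - weight G k (shift l {i}, J - {i}))) (\<psi>' (shift l {i}, J - {i})) -
      Upow (nat (weight G k (l, J) - weight G k (l, J - {i}))) (\<psi>' (l, J - {i})))" for i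
    have "D i = 0" if "i \<in> J - {j}" for i
      using that by (simp add: D_def no_S I)
    then have "(\<Sum>i\<in>J. D i) = D j" using \<open>j \<in> J\<close> by (subst sum.remove[of J j]) auto
    moreover have "delta G k q \<psi>' (l, J) = (\<Sum>i\<in>J. D i)" unfolding delta_eq[OF that(2)] D_def ..
    moreover have "D j = \<phi> (l, J)"
    proof -
      have outer: "\<psi>' (x, I) =
         Upow (nat (weight G k (x, I) - weight G k (x(j := c + d), I))) (\<psi> (x(j := c + d), I)) +
         (if d = 1 then - face_sign j J (\<phi> (l, J)) else face_sign j J (\<phi> (l, J)))"
        unfolding \<psi>'_def prod.case b I(2) using I(1) xj xI by simp
      have "(x(j := c + d), I) \<in> cubes_in S"
        using p(3) I d by (auto simp: cubes_in_def S_eq shift_def)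
      then have inner: "\<psi>' (x(j := c + d), I) = \<psi> (x(j := c + d), I)" by (rule agree)
      show ?thesis
        using d
      proof
        assume d1: "d = 1"
        then have "l = x" "shift l {j} = x(j := c + d)" using p(4) by auto
        then show ?thesis using outer inner p(2) d1 by (simp add: D_def I)
      next
        assume d1: "d = - 1"
        then have "x = shift l {j}" "l = x(j := c + d)" using p(5) by auto
        then show ?thesis using outer inner p(2) d1 by (simp add: D_def I)
      qed
    qed
    ultimately show ?thesis by simp
  qed
  \<comment> \<open>the slice cubes of dimension \<open>q + 1\<close> need no further choice, as \<open>\<theta>\<close> is a cocycle\<close>
  define \<theta> where "\<theta> = (\<lambda>c. delta G k q \<psi>' c - \<phi> c)"
  have \<theta>: "delta G k (Suc q) \<theta> c = 0" for c
    unfolding \<theta>_def delta_diff using cocycle by (simp add: delta_delta)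
  have "\<theta> (l, I) = 0" if "(l, I) \<in> cubes_in R" "card I = Suc q" "j \<in> I \<or> l j \<noteq> c" for l I
  proof (cases "(l, I) \<in> cubes_in S")
    case True
    then show ?thesis using on_S that by (simp add: \<theta>_def)
  next
    case False
    have "j \<in> I"
    proof (rule ccontr)
      assume "j \<notin> I"
      then have "(l, I) \<in> cubes_in S" using that by (auto simp: cubes_in_def S_eq shift_def)
      then show False using False by simp
    qed
    then show ?thesis using on_prism that False by (simp add: \<theta>_def)
  qed
  then have "\<theta> (l, I) = 0" if "(l, I) \<in> cubes_in R" "card I = Suc q" for l I
    using vanish_on_slice[OF col \<theta>] that by blast
  then show ?thesis using agree by (intro exI[of _ \<psi>']) (auto simp: \<theta>_def)
qed

lemma extend_collapses:
  assumes "(collapses_to (chi G k))\<^sup>*\<^sup>* R S"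
    and cocycle: "\<And>c. delta G k (Suc q) \<phi> c = 0"
    and "\<forall>(l, I)\<in>cubes_in S. card I = Suc q \<longrightarrow> delta G k q \<psi> (l, I) = \<phi> (l, I)"
  shows "\<exists>\<psi>'. (\<forall>c\<in>cubes_in S. \<psi>' c = \<psi> c) \<and>
    (\<forall>(l, I)\<in>cubes_in R. card I = Suc q \<longrightarrow> delta G k q \<psi>' (l, I) = \<phi> (l, I))"
  using assms(1,3)
proof (induction arbitrary: \<psi> rule: rtranclp_induct)
  case base
  then show ?case by blast
next
  case (step S T)
  obtain \<psi>1 where 1: "\<forall>c\<in>cubes_in T. \<psi>1 c = \<psi> c"
    "\<forall>(l, I)\<in>cubes_in S. card I = Suc q \<longrightarrow> delta G k q \<psi>1 (l, I) = \<phi> (l, I)"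
    using extend_collapse[OF step(2) cocycle, where \<psi> = \<psi>] step(4) by blast
  obtain \<psi>2 where 2: "\<forall>c\<in>cubes_in S. \<psi>2 c = \<psi>1 c"
    "\<forall>(l, I)\<in>cubes_in R. card I = Suc q \<longrightarrow> delta G k q \<psi>2 (l, I) = \<phi> (l, I)"
    using step(3)[OF 1(2)] by blast
  have "T \<subseteq> S" using step(2) by (auto simp: collapses_to_def)
  then have "cubes_in T \<subseteq> cubes_in S" by (auto simp: cubes_in_def)
  then show ?case using 1 2 by (intro exI[of _ \<psi>2]) auto
qed

lemma vanish_collapses:
  assumes "(collapses_to (chi G k))\<^sup>*\<^sup>* R S"
    and cocycle: "\<And>c. delta G k 0 \<theta> c = 0"
    and "\<forall>x\<in>S. \<theta> (x, {}) = 0"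
  shows "\<forall>x\<in>R. \<theta> (x, {}) = 0"
  using assms(1,3)
proof (induction rule: rtranclp_induct)
  case base
  then show ?case by blast
next
  case (step S T)
  obtain j c d where c: "collapse (chi G k) j c d S" "T = {x\<in>S. x j \<noteq> c}"
    using step by (auto simp: collapses_to_def)
  have "\<theta> (x, {}) = 0" if "x \<in> S" for x
    by (rule vanish_on_slice[OF c(1) cocycle]) (use that c step(4) in \<open>auto simp: cubes_in_def\<close>)
  then show ?case using step(3) by blast
qed


lemma mem_cochain_group: "\<phi> \<in> carrier (cochain_group q) \<longleftrightarrow> (\<forall>l I. card I \<noteq> q \<longrightarrow> \<phi> (l, I) = 0)"
  by (auto simp: cochain_group_def cubes_def)

lemma mem_cocycles:
  "\<phi> \<in> cocycles G k q \<longleftrightarrow> \<phi> \<in> carrier (cochain_group q) \<and> (\<forall>c. delta G k q \<phi> c = 0)"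
  by (auto simp: cocycles_def fun_eq_iff)

lemma cocyclesD: "\<phi> \<in> cocycles G k q \<Longrightarrow> delta G k q \<phi> c = 0"
  by (simp add: cocycles_def)

lemma cubes_in_Union:
  assumes mono: "\<And>n. R n \<subseteq> R (Suc n)" and cover: "(\<Union>n::nat. R n) = UNIV"
  shows "\<exists>n. ((l :: 'v \<Rightarrow> int), I) \<in> cubes_in (R n)"
proof -
  have "\<forall>J. \<exists>n. shift l J \<in> R n" using cover by auto
  then obtain n where n: "\<And>J. shift l J \<in> R (n J)" by metis
  have "shift l J \<in> R (Max (range n))" for J
  proof -
    have "n J \<le> Max (range n)" by simp
    then have "R (n J) \<subseteq> R (Max (range n))" using lift_Suc_mono_le[of R] mono by blast
    then show ?thesis using n by blast
  qed
  then show ?thesis by (auto simp: cubes_in_def)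
qed

text \<open>Primitives on an exhaustion of the lattice, each extending the previous one, glue to a primitive on
  the whole lattice; no finiteness of the cochains is involved.\<close>

lemma delta_solvable:
  assumes point: "(collapses_to (chi G k))\<^sup>*\<^sup>* (R 0) {p}"
    and chain: "\<And>n. (collapses_to (chi G k))\<^sup>*\<^sup>* (R (Suc n)) (R n)"
    and cover: "(\<Union>n. R n) = UNIV"
    and \<phi>: "\<phi> \<in> cocycles G k (Suc q)"
  shows "\<exists>\<psi>\<in>carrier (cochain_group q). delta G k q \<psi> = \<phi>"
proof -
  have cocycle: "delta G k (Suc q) \<phi> c = 0" for c
    using \<phi> by (rule cocyclesD)
  have mono: "R n \<subseteq> R (Suc n)" for n using collapses_subset[OF chain] .
  define P where "P n \<psi> \<longleftrightarrow>
      (\<forall>(l, I)\<in>cubes_in (R n). card I = Suc q \<longrightarrow> delta G k q \<psi> (l, I) = \<phi> (l, I))" for n \<psi>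
  have "I = {}" if "(l, I) \<in> cubes_in {p}" for l I
  proof (rule ccontr)
    assume "I \<noteq> {}"
    then obtain i where "i \<in> I" by blast
    then have "shift l {} = p" "shift l {i} = p" using that unfolding cubes_in_def by blast+
    then have "shift l {i} i = l i" by simp
    then show False by (simp add: shift_def)
  qed
  then have "\<forall>(l, I)\<in>cubes_in {p}. card I = Suc q \<longrightarrow> delta G k q (\<lambda>_. 0) (l, I) = \<phi> (l, I)"
    by fastforce
  from extend_collapses[OF point cocycle this] have start: "\<exists>\<psi>. P 0 \<psi>"
    unfolding P_def by blast
  define Q where "Q n \<psi> \<psi>' \<longleftrightarrow> (\<forall>c\<in>cubes_in (R n). \<psi>' c = \<psi> c)" for n and \<psi> \<psi>' :: "'v cochain"
  have step: "\<exists>\<psi>'. P (Suc n) \<psi>' \<and> Q n \<psi> \<psi>'" if "P n \<psi>" for n \<psi>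
    using extend_collapses[OF chain cocycle that[unfolded P_def]] unfolding P_def Q_def by blast
  obtain \<Psi> where \<Psi>: "\<And>n. P n (\<Psi> n)" "\<And>n. Q n (\<Psi> n) (\<Psi> (Suc n))"
    using dependent_nat_choice[of P Q, OF start step] by metis
  have agree: "\<Psi> m c = \<Psi> n c" if "n \<le> m" "c \<in> cubes_in (R n)" for m n c
    using that(1)
  proof (induction m rule: dec_induct)
    case (step m)
    have "R n \<subseteq> R m" using lift_Suc_mono_le[of R] mono step(1) by blast
    then have "c \<in> cubes_in (R m)" using that(2) by (auto simp: cubes_in_def)
    then show ?case using \<Psi>(2)[of m] step unfolding Q_def by simp
  qed simp
  have ex: "\<exists>n. (l, I) \<in> cubes_in (R n)" for l I
    using cubes_in_Union mono cover by blast
  \<comment> \<open>a cube takes its value from the first set of the exhaustion that contains it\<close>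
  define \<psi> where "\<psi> = (\<lambda>(l, I). if card I = q then \<Psi> (LEAST n. (l, I) \<in> cubes_in (R n)) (l, I) else 0)"
  have \<psi>: "\<psi> (l, I) = \<Psi> n (l, I)" if "(l, I) \<in> cubes_in (R n)" "card I = q" for l I n
  proof -
    have "(LEAST n. (l, I) \<in> cubes_in (R n)) \<le> n" by (rule Least_le) fact
    moreover have "(l, I) \<in> cubes_in (R (LEAST n. (l, I) \<in> cubes_in (R n)))"
      by (rule LeastI) fact
    ultimately show ?thesis using that agree by (simp add: \<psi>_def)
  qed
  have "delta G k q \<psi> (l, I) = \<phi> (l, I)" for l I
  proof (cases "card I = Suc q")
    case True
    obtain n where n: "(l, I) \<in> cubes_in (R n)" using ex by blast
    have "delta G k q \<psi> (l, I) = delta G k q (\<Psi> n) (l, I)"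
      unfolding delta_eq[OF True]
      by (intro sum.cong refl) (simp add: \<psi>[OF cubes_in_faces(1)[OF n]] \<psi>[OF cubes_in_faces(2)[OF n]] True)
    also have "\<dots> = \<phi> (l, I)" using \<Psi>(1)[of n] n True unfolding P_def by blast
    finally show ?thesis .
  next
    case False
    then show ?thesis using \<phi> by (simp add: delta_outside mem_cocycles mem_cochain_group)
  qed
  then have "delta G k q \<psi> = \<phi>" by auto
  moreover have "\<psi> \<in> carrier (cochain_group q)" by (simp add: mem_cochain_group \<psi>_def)
  ultimately show ?thesis by blast
qed

lemma cocycles_eq_reduced_coboundaries:
  assumes point: "(collapses_to (chi G k))\<^sup>*\<^sup>* (R 0) {p}"
    and chain: "\<And>n. (collapses_to (chi G k))\<^sup>*\<^sup>* (R (Suc n)) (R n)"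
    and cover: "(\<Union>n. R n) = UNIV"
  shows "cocycles G k q = reduced_coboundaries G k q"
proof (cases q)
  case (Suc q')
  have "delta G k q' \<psi> \<in> cocycles G k (Suc q')" for \<psi>
    by (simp add: mem_cocycles mem_cochain_group delta_delta delta_outside)
  then show ?thesis
    unfolding Suc reduced_coboundaries.simps
    using delta_solvable[OF point chain cover] by (blast intro: sym)
next
  case 0
  have to_p: "(collapses_to (chi G k))\<^sup>*\<^sup>* (R n) {p}" for n
    by (induction n) (use point chain in \<open>auto intro: rtranclp_trans\<close>)
  have min: "chi G k p \<le> chi G k x" for x
  proof -
    obtain n where "x \<in> R n" using cover by blast
    then show ?thesis using collapses_below[OF to_p] by blast
  qed
  have m: "m_min G k = chi G k p"
    unfolding m_min_def by (rule cInf_eq_minimum) (use min in blast)+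
  have w0: "weight G k (l, {}) = chi G k l" for l by (simp add: weight_eq)
  have aug: "augmentation G k t (l, {}) = Upow (nat (chi G k l - chi G k p)) t" for t l
    by (simp add: augmentation_def cubes_def m w0)
  have aug': "augmentation G k t \<in> carrier (cochain_group 0)" for t
    by (simp add: mem_cochain_group augmentation_def cubes_def)
  have aug_cocycle: "delta G k 0 (augmentation G k t) c = 0" for t c
  proof (cases c)
    case (Pair l I)
    show ?thesis
    proof (cases "card I = Suc 0")
      case True
      then obtain i where I: "I = {i}" using card_1_singletonE by (metis One_nat_def)
      have e: "nat (weight G k (l, {i}) - chi G k x) + nat (chi G k x - chi G k p) =
          nat (weight G k (l, {i}) - chi G k p)" if "chi G k x \<le> weight G k (l, {i})" for x
        using min[of x] that by linarith
      have "chi G k (shift l {i}) \<le> weight G k (l, {i})" "chi G k (shift l {}) \<le> weight G k (l, {i})"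
        by (rule weight_ge; simp)+
      then show ?thesis by (simp add: Pair I delta_eq aug w0 Upow_Upow e)
    qed (simp add: Pair delta_outside)
  qed
  have "\<phi> \<in> range (augmentation G k)" if \<phi>: "\<phi> \<in> cocycles G k 0" for \<phi>
  proof -
    \<comment> \<open>the augmentation of \<open>t\<close> has the value \<open>t\<close> at the minimum \<open>p\<close> of \<open>\<chi>\<close>, so \<open>\<theta>\<close> vanishes at \<open>p\<close>\<close>
    define \<theta> where "\<theta> = (\<lambda>c. \<phi> c - augmentation G k (\<phi> (p, {})) c)"
    have \<theta>: "delta G k 0 \<theta> c = 0" for c
      unfolding \<theta>_def delta_diff by (simp add: aug_cocycle cocyclesD[OF \<phi>])
    have "\<theta> (x, {}) = 0" for x
    proof -
      obtain n where "x \<in> R n" using cover by blast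
      moreover have "\<theta> (p, {}) = 0" by (simp add: \<theta>_def aug)
      ultimately show ?thesis using vanish_collapses[OF to_p \<theta>] by blast
    qed
    moreover have "\<theta> (x, I) = 0" if "card I \<noteq> 0" for x I
      using that \<phi> aug' by (auto simp: \<theta>_def mem_cochain_group mem_cocycles)
    ultimately have "\<theta> (x, I) = 0" for x I by (cases "I = {}") (auto simp: card_eq_0_iff)
    then have "\<phi> = augmentation G k (\<phi> (p, {}))"
      unfolding \<theta>_def by (metis eq_iff_diff_eq_0 ext old.prod.exhaust)
    then show ?thesis by blast
  qed
  moreover have "augmentation G k t \<in> cocycles G k 0" for t
    using aug' aug_cocycle unfolding mem_cocycles by blast
  ultimately show ?thesis unfolding 0 reduced_coboundaries.simps by blast
qed

lemma trivial_reduced_cohomology: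
  assumes "cocycles G k q = reduced_coboundaries G k q"
  shows "trivial_group (reduced_lattice_cohomology G k q)"
proof -
  define H where "H = (cochain_group q :: 'v cochain monoid)\<lparr>carrier := cocycles G k q\<rparr>"
  have H_simps: "carrier H = cocycles G k q" "mult H = (\<lambda>\<phi> \<psi> c. \<phi> c + \<psi> c)" "one H = (\<lambda>_. 0)"
    by (auto simp: H_def cochain_group_def)
  have zero: "(\<lambda>_. 0) \<in> cocycles G k q"
  proof -
    have "delta G k q (\<lambda>_. 0) c = 0" for c using delta_diff[of q "\<lambda>_. 0" "\<lambda>_. 0" c] by simp
    then show ?thesis by (simp add: mem_cocycles mem_cochain_group)
  qed
  have diff: "(\<lambda>c. \<phi> c - \<psi> c) \<in> cocycles G k q" if "\<phi> \<in> cocycles G k q" "\<psi> \<in> cocycles G k q" for \<phi> \<psi>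
    using that by (simp add: mem_cocycles mem_cochain_group delta_diff)
  have add: "(\<lambda>c. \<phi> c + \<psi> c) \<in> cocycles G k q" if "\<phi> \<in> cocycles G k q" "\<psi> \<in> cocycles G k q" for \<phi> \<psi>
    using diff[OF that(1) diff[OF zero that(2)]] by simp
  have "comm_group H"
  proof (rule comm_groupI)
    fix \<phi> assume "\<phi> \<in> carrier H"
    then show "\<exists>\<psi>\<in>carrier H. \<psi> \<otimes>\<^bsub>H\<^esub> \<phi> = \<one>\<^bsub>H\<^esub>"
      using diff[OF zero, of \<phi>] by (auto simp: H_simps fun_eq_iff intro!: bexI[of _ "\<lambda>c. 0 - \<phi> c"])
  qed (auto simp: H_simps zero add add_ac)
  then interpret comm_group H .
  have H: "reduced_lattice_cohomology G k q = H Mod carrier H"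
    by (simp add: reduced_lattice_cohomology_def H_def assms)
  interpret N: normal "carrier H" H
    by (rule subgroup_imp_normal) (rule subgroup_self)
  have "carrier (H Mod carrier H) = {carrier H}"
  proof -
    have "carrier H #>\<^bsub>H\<^esub> x = carrier H" if "x \<in> carrier H" for x
      using coset_join2[OF that subgroup_self that] .
    then have "(\<Union>x\<in>carrier H. {carrier H #>\<^bsub>H\<^esub> x}) = (\<Union>x\<in>carrier H. {carrier H})" by simp
    then show ?thesis using one_closed by (simp add: FactGroup_def RCOSETS_def UN_constant) blast
  qed
  then show ?thesis
    unfolding H trivial_group_def using N.factorgroup_is_group by (simp add: FactGroup_def)
qed

end

section \<open>Negative definite forms and collapses of boxes\<close>

lemma clear_denominators:
  fixes v :: "'v::finite \<Rightarrow> rat"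
  shows "\<exists>N x. N > (0::int) \<and> (\<forall>i. of_int (x i) = of_int N * v i)"
proof -
  define d where "d i = snd (quotient_of (v i))" for i
  define N where "N = (\<Prod>i\<in>UNIV. d i)"
  have d: "d i > 0" for i by (simp add: d_def quotient_of_denom_pos')
  have "\<exists>x::int. of_int x = of_int N * v i" for i
  proof -
    have v: "v i = of_int (fst (quotient_of (v i))) / of_int (d i)"
      unfolding d_def by (metis quotient_of_div prod.collapse)
    have "N = d i * (\<Prod>i\<in>UNIV - {i}. d i)" unfolding N_def by (rule prod.remove) auto
    then have "of_int N * v i = of_int ((\<Prod>i\<in>UNIV - {i}. d i) * fst (quotient_of (v i)))"
      using d[of i] by (subst v) (simp del: quotient_of_div)
    then show ?thesis by metis
  qed
  then obtain x where "\<And>i. of_int (x i) = of_int N * v i" by metis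
  moreover have "N > 0" unfolding N_def using d by (intro prod_pos) auto
  ultimately show ?thesis by blast
qed

text \<open>An integral negative definite form on the lattice of all \<open>'v \<Rightarrow> int\<close>, given by its matrix, with
  nonnegative entries off the diagonal.\<close>

locale negative_definite_form =
  fixes A :: "'v::finite \<Rightarrow> 'v \<Rightarrow> int"
  assumes mat_sym: "A i j = A j i"
    and offdiag: "i \<noteq> j \<Longrightarrow> 0 \<le> A i j"
    and negdef: "l \<noteq> (\<lambda>_. 0) \<Longrightarrow> (\<Sum>j\<in>UNIV. l j * (\<Sum>i\<in>UNIV. l i * A i j)) < 0"
begin

text \<open>The intersection number of the lattice point \<open>x\<close> with the basis vector at \<open>j\<close>.\<close>

definition pair :: "('v \<Rightarrow> int) \<Rightarrow> 'v \<Rightarrow> int" where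
  "pair x j = (\<Sum>i\<in>UNIV. x i * A i j)"

lemma pair_diff: "pair (\<lambda>i. x i - y i) j = pair x j - pair y j"
  and pair_uminus: "pair (\<lambda>i. - x i) j = - pair x j"
  by (simp_all add: pair_def distrib_right left_diff_distrib sum.distrib sum_subtractf sum_negf)

lemma pair_scale: "pair (\<lambda>i. n * x i) j = n * pair x j"
  by (simp add: pair_def mult.assoc sum_distrib_left)

lemma pair_upd: "pair (x(j := x j + n)) j = pair x j + n * A j j"
proof -
  have "pair (x(j := x j + n)) j = (\<Sum>i\<in>UNIV. x i * A i j + (if i = j then n * A j j else 0))"
    unfolding pair_def by (intro sum.cong refl) (auto simp: algebra_simps)
  then show ?thesis by (simp add: sum.distrib pair_def)
qed

lemma pair_step: "pair (x(j := x j + 1)) i = pair x i + A j i"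
proof -
  have "pair (x(j := x j + 1)) i = (\<Sum>m\<in>UNIV. x m * A m i + (if m = j then A j i else 0))"
    unfolding pair_def by (intro sum.cong refl) (auto simp: algebra_simps)
  then show ?thesis by (simp add: sum.distrib pair_def)
qed

lemma quadratic_step:
  fixes \<kappa> :: "'v \<Rightarrow> int"
  defines "Q \<equiv> \<lambda>x. \<Sum>i\<in>UNIV. x i * (pair x i + \<kappa> i)"
  shows "Q (x(j := x j + 1)) = Q x + 2 * pair x j + A j j + \<kappa> j"
proof -
  have "Q (x(j := x j + 1)) = (\<Sum>i\<in>UNIV. x i * (pair x i + \<kappa> i) + x i * A i j +
      (if i = j then pair x j + A j j + \<kappa> j else 0))"
    unfolding Q_def pair_step
    by (intro sum.cong refl) (auto simp: algebra_simps mat_sym)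
  then show ?thesis by (simp add: sum.distrib pair_def Q_def)
qed

lemma pair_mono:
  assumes "x \<le> y" "x j = y j"
  shows "pair x j \<le> pair y j"
  unfolding pair_def
proof (rule sum_mono)
  fix i show "x i * A i j \<le> y i * A i j"
    using assms offdiag[of i j] by (cases "i = j") (auto simp: le_fun_def intro!: mult_right_mono)
qed

lemma negdef_pair: "l \<noteq> (\<lambda>_. 0) \<Longrightarrow> (\<Sum>j\<in>UNIV. l j * pair l j) < 0"
  using negdef by (simp add: pair_def)

lemma negative_direction:
  assumes "\<And>i. 0 \<le> l i" "l \<noteq> (\<lambda>_. 0)"
  shows "\<exists>j. 0 < l j \<and> pair l j < 0"
proof (rule ccontr)
  assume "\<nexists>j. 0 < l j \<and> pair l j < 0"
  then have "l j = 0 \<or> 0 \<le> pair l j" for j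
    using assms(1)[of j] by (meson linorder_not_less order.order_iff_strict)
  then have "0 \<le> l j * pair l j" for j
    using assms(1)[of j] by (metis mult_nonneg_nonneg mult_zero_left order_refl)
  then have "0 \<le> (\<Sum>j\<in>UNIV. l j * pair l j)" by (intro sum_nonneg) auto
  then show False using negdef_pair[OF assms(2)] by simp
qed

text \<open>A multiple of a rational vector in the kernel is integral, and the form vanishes on it.\<close>

lemma kernel_trivial:
  fixes v :: "'v \<Rightarrow> rat"
  assumes "\<And>j. (\<Sum>i\<in>UNIV. v i * of_int (A i j)) = 0"
  shows "v i = 0"
proof -
  obtain N x where N: "N > 0" "\<And>i. of_int (x i) = of_int N * v i"
    using clear_denominators[of v] by blast
  have "pair x j = 0" for j
  proof -
    have "rat_of_int (pair x j) = of_int N * (\<Sum>i\<in>UNIV. v i * of_int (A i j))"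
      by (simp add: pair_def N(2) sum_distrib_left mult.assoc)
    then show ?thesis using assms by simp
  qed
  then have "x = (\<lambda>_. 0)" using negdef_pair[of x] by auto
  then show ?thesis using N(1) N(2)[of i] by simp
qed

text \<open>A linear endomorphism with trivial kernel is surjective, here over the rationals.\<close>

lemma nondegenerate: "\<exists>z :: 'v \<Rightarrow> rat. \<forall>j. (\<Sum>i\<in>UNIV. z i * of_int (A i j)) = c j"
proof -
  define F :: "rat ^ 'v \<Rightarrow> rat ^ 'v" where "F v = (\<chi> j. \<Sum>i\<in>UNIV. v $ i * of_int (A i j))" for v
  have lin: "Vector_Spaces.linear (*s) (*s) F"
    by unfold_locales
      (auto simp: F_def vec_eq_iff algebra_simps sum.distrib sum_distrib_left)
  have "v = 0" if "F v = 0" for v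
    using that kernel_trivial[of "\<lambda>i. v $ i"] by (simp add: F_def vec_eq_iff)
  moreover have "F (v - w) = F v - F w" for v w
    by (simp add: F_def vec_eq_iff left_diff_distrib sum_subtractf)
  ultimately have "inj F" by (metis (no_types) eq_iff_diff_eq_0 injI)
  then have "surj F" by (rule vec.linear_inj_imp_surj[OF lin])
  then obtain v where "F v = (\<chi> j. c j)" by (metis surjD)
  then show ?thesis
    by (intro exI[of _ "\<lambda>i. v $ i"]) (auto simp: F_def vec_eq_iff)
qed

text \<open>If \<open>q\<close> is the negative part of \<open>Z\<close>, then \<open>(q, Z) \<ge> - (q, q)\<close>, because the positive and the negative part have
  disjoint supports. This is positive unless \<open>q = 0\<close>, while \<open>(q, Z) \<le> 0\<close> by the hypothesis.\<close>

lemma positive_if_pair_negative: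
  assumes neg: "\<And>j. pair Z j < 0"
  shows "0 < Z j"
proof -
  define q where "q i = max 0 (- Z i)" for i
  define p where "p i = max 0 (Z i)" for i
  have Z: "Z i = p i - q i" for i by (simp add: p_def q_def max_def)
  have "q = (\<lambda>_. 0)"
  proof (rule ccontr)
    assume "q \<noteq> (\<lambda>_. 0)"
    then have "(\<Sum>j\<in>UNIV. q j * pair q j) < 0" by (rule negdef_pair)
    moreover have "0 \<le> (\<Sum>j\<in>UNIV. q j * pair p j)"
      unfolding pair_def sum_distrib_left
    proof (intro sum_nonneg)
      fix j i
      show "0 \<le> q j * (p i * A i j)"
        using offdiag[of i j] by (cases "i = j") (auto simp: p_def q_def max_def)
    qed
    moreover have "(\<Sum>j\<in>UNIV. q j * pair Z j) \<le> 0"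
      using neg by (intro sum_nonpos mult_nonneg_nonpos) (auto simp: q_def less_imp_le)
    moreover have "pair Z j = pair p j - pair q j" for j
      using pair_diff[of p q j] by (simp add: Z[symmetric])
    ultimately show False by (simp add: right_diff_distrib sum_subtractf)
  qed
  then have nonneg: "0 \<le> Z i" for i using Z[of i] by (simp add: p_def)
  have "Z j \<noteq> 0"
  proof
    assume Zj: "Z j = 0"
    have "0 \<le> pair Z j" unfolding pair_def
    proof (rule sum_nonneg)
      fix i show "0 \<le> Z i * A i j"
        using nonneg[of i] offdiag[of i j] Zj by (cases "i = j") auto
    qed
    then show False using neg[of j] by simp
  qed
  then show ?thesis using nonneg[of j] by simp
qed

text \<open>Clear denominators in the rational solution \<open>z\<close> of \<open>(z, E\<^sub>j) = - 1\<close> for all \<open>j\<close>.\<close>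

lemma exists_antinef: "\<exists>Z. \<forall>j. pair Z j < 0"
proof -
  obtain z where z: "\<And>j. (\<Sum>i\<in>UNIV. z i * rat_of_int (A i j)) = - 1"
    using nondegenerate[of "\<lambda>_. - 1"] by blast
  obtain N Z where N: "N > 0" "\<And>i. rat_of_int (Z i) = of_int N * z i"
    using clear_denominators[of z] by blast
  have "pair Z j < 0" for j
  proof -
    have "rat_of_int (pair Z j) = of_int N * (\<Sum>i\<in>UNIV. z i * of_int (A i j))"
      by (simp add: pair_def N(2) sum_distrib_left mult.assoc)
    then have "rat_of_int (pair Z j) < 0" using z N(1) by simp
    then show ?thesis by simp
  qed
  then show ?thesis by blast
qed

end

text \<open>A function with the increments of a Riemann-Roch function: each \<open>\<chi>\<^sub>k\<close> satisfies
  \<open>\<chi>\<^sub>k(x + E\<^sub>j) = \<chi>\<^sub>k(x) + \<chi>\<^sub>k(E\<^sub>j) - (x, E\<^sub>j)\<close>.\<close>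

locale riemann_roch_function = negative_definite_form A
  for A :: "'v::finite \<Rightarrow> 'v \<Rightarrow> int" +
  fixes f :: "('v \<Rightarrow> int) \<Rightarrow> int" and c :: "'v \<Rightarrow> int"
  assumes f_step: "f (x(j := x j + 1)) = f x + c j - pair x j"
begin

lemma le_upd_iff: "x \<le> b(j := b j - 1) \<longleftrightarrow> x \<le> b \<and> x j < b j" for x b :: "'v \<Rightarrow> int"
proof
  assume L: "x \<le> b(j := b j - 1)"
  have "x i \<le> b i" for i using le_funD[OF L, of i] by (cases "i = j") auto
  moreover have "x j < b j" using le_funD[OF L, of j] by simp
  ultimately show "x \<le> b \<and> x j < b j" by (simp add: le_fun_def)
next
  assume "x \<le> b \<and> x j < b j"
  then show "x \<le> b(j := b j - 1)" by (simp add: le_fun_def)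
qed

lemma upd_le_iff: "a(j := a j + 1) \<le> x \<longleftrightarrow> a \<le> x \<and> a j < x j" for x a :: "'v \<Rightarrow> int"
proof
  assume L: "a(j := a j + 1) \<le> x"
  have "a i \<le> x i" for i using le_funD[OF L, of i] by (cases "i = j") auto
  moreover have "a j < x j" using le_funD[OF L, of j] by simp
  ultimately show "a \<le> x \<and> a j < x j" by (simp add: le_fun_def)
next
  assume "a \<le> x \<and> a j < x j"
  then show "a(j := a j + 1) \<le> x" by (simp add: le_fun_def)
qed

lemma f_step_down: "f (x(j := x j - 1)) = f x - c j + pair x j - A j j"
  using f_step[of "x(j := x j - 1)" j] pair_upd[of x j "- 1"] by simp

text \<open>If \<open>f\<close> does not increase from the top corner \<open>b\<close> of a box to its neighbour \<open>b - E\<^sub>j\<close>, then the same holds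
  at each point of the upper face of the box orthogonal to \<open>E\<^sub>j\<close>, because entries off the diagonal are
  nonnegative. The hypothesis on \<open>pair b j\<close> says just that; dually for the bottom corner.\<close>

lemma collapse_top:
  assumes "a \<le> b" "a j < b j" "pair b j \<le> c j + A j j"
  shows "collapses_to f {a..b} {a..b(j := b j - 1)}"
proof -
  have "x(j := b j - 1) \<in> {a..b} \<and> f (x(j := b j - 1)) \<le> f x" if "x \<in> {a..b}" "x j = b j" for x
  proof -
    have "pair x j \<le> pair b j" using that by (intro pair_mono) auto
    then have "f (x(j := x j - 1)) \<le> f x" using f_step_down[of x j] assms(3) by simp
    then show ?thesis using that assms(2) by (auto simp: le_fun_def)
  qed
  then have "collapse f j (b j) (- 1) {a..b}"
    by (auto simp: collapse_def le_fun_def)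
  moreover have "{a..b(j := b j - 1)} = {x\<in>{a..b}. x j \<noteq> b j}"
    by (auto simp: le_upd_iff) (auto simp: le_fun_def less_le)
  ultimately show ?thesis unfolding collapses_to_def by blast
qed

lemma collapse_bottom:
  assumes "a \<le> b" "a j < b j" "c j \<le> pair a j"
  shows "collapses_to f {a..b} {a(j := a j + 1)..b}"
proof -
  have "x(j := a j + 1) \<in> {a..b} \<and> f (x(j := a j + 1)) \<le> f x" if "x \<in> {a..b}" "x j = a j" for x
  proof -
    have "pair a j \<le> pair x j" using that by (intro pair_mono) auto
    then have "f (x(j := x j + 1)) \<le> f x" using f_step[of x j] assms(3) by simp
    then show ?thesis using that assms(2) by (auto simp: le_fun_def)
  qed
  then have "collapse f j (a j) 1 {a..b}"
    by (auto simp: collapse_def le_fun_def)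
  moreover have "{a(j := a j + 1)..b} = {x\<in>{a..b}. x j \<noteq> a j}"
    by (auto simp: upd_le_iff) (auto simp: le_fun_def less_le)
  ultimately show ?thesis unfolding collapses_to_def by blast
qed

lemma sum_upd: "(\<Sum>i\<in>UNIV. (x(j := x j + n)) i) = (\<Sum>i\<in>UNIV. x i) + (n::int)" for x :: "'v \<Rightarrow> int"
proof -
  have "(\<Sum>i\<in>UNIV. (x(j := x j + n)) i) = (\<Sum>i\<in>UNIV. x i + (if i = j then n else 0))"
    by (intro sum.cong refl) auto
  then show ?thesis by (simp add: sum.distrib)
qed

text \<open>Far out, the slices outside of a box \<open>[a, b]\<close> can be removed without touching the box: if
  \<open>b' = b + l\<close> with \<open>l > 0\<close>, then \<open>(l, E\<^sub>j) < 0\<close> for some \<open>j\<close> in the support of \<open>l\<close>.\<close>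

lemma collapse_outer_box:
  assumes "a \<le> b" "a' \<le> a" "b \<le> b'"
    and top: "\<And>j. pair b j \<le> c j + A j j" and bot: "\<And>j. c j \<le> pair a j"
  shows "(collapses_to f)\<^sup>*\<^sup>* {a'..b'} {a..b}"
  using assms(2,3)
proof (induction "nat ((\<Sum>i\<in>UNIV. b' i) - (\<Sum>i\<in>UNIV. a' i))" arbitrary: a' b' rule: less_induct)
  case less
  have "a' \<le> b'" using less.prems assms(1) by (meson order_trans)
  then have sum_less: "(\<Sum>i\<in>UNIV. a' i) < (\<Sum>i\<in>UNIV. b' i)" if "a' i < b' i" for i
    using that by (intro sum_strict_mono_ex1) (auto simp: le_fun_def)
  consider "b' = b" "a' = a" | "b' \<noteq> b" | "a \<noteq> a'" by blast
  then show ?case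
  proof cases
    case 1
    then show ?thesis by simp
  next
    case 2
    define l where "l = (\<lambda>i. b' i - b i)"
    have "l \<noteq> (\<lambda>_. 0)" using 2 by (auto simp: l_def fun_eq_iff)
    moreover have "0 \<le> l i" for i using less.prems by (auto simp: l_def le_fun_def)
    ultimately obtain j where j: "0 < l j" "pair l j < 0" using negative_direction by blast
    have lt: "b j < b' j" using j by (simp add: l_def)
    have "a' j < b' j" using lt less.prems assms(1) by (meson le_funD order.strict_trans1 order_trans)
    moreover have "pair b' j \<le> c j + A j j"
      using top[of j] j(2) pair_diff[of b' b j] by (simp add: l_def)
    ultimately have *: "collapses_to f {a'..b'} {a'..b'(j := b' j - 1)}" using \<open>a' \<le> b'\<close> by (intro collapse_top)
    have "(collapses_to f)\<^sup>*\<^sup>* {a'..b'(j := b' j - 1)} {a..b}"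
    proof (rule less.hyps)
      show "b \<le> b'(j := b' j - 1)" using lt less.prems by (auto simp: le_fun_def)
      show "nat (sum (b'(j := b' j - 1)) UNIV - sum a' UNIV) < nat (sum b' UNIV - sum a' UNIV)"
        using sum_upd[of b' j "- 1"] sum_less[OF \<open>a' j < b' j\<close>] by simp
    qed (use less.prems in simp)
    then show ?thesis using * by (meson converse_rtranclp_into_rtranclp)
  next
    case 3
    define l where "l = (\<lambda>i. a i - a' i)"
    have "l \<noteq> (\<lambda>_. 0)" using 3 by (auto simp: l_def fun_eq_iff)
    moreover have "0 \<le> l i" for i using less.prems by (auto simp: l_def le_fun_def)
    ultimately obtain j where j: "0 < l j" "pair l j < 0" using negative_direction by blast
    have lt: "a' j < a j" using j by (simp add: l_def)
    have "a' j < b' j" using lt less.prems assms(1) by (meson le_funD order.strict_trans2 order_trans)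
    moreover have "c j \<le> pair a' j"
      using bot[of j] j(2) pair_diff[of a a' j] by (simp add: l_def)
    ultimately have *: "collapses_to f {a'..b'} {a'(j := a' j + 1)..b'}" using \<open>a' \<le> b'\<close> by (intro collapse_bottom)
    have "(collapses_to f)\<^sup>*\<^sup>* {a'(j := a' j + 1)..b'} {a..b}"
    proof (rule less.hyps)
      show "a'(j := a' j + 1) \<le> a" using lt less.prems by (auto simp: le_fun_def)
      show "nat (sum b' UNIV - sum (a'(j := a' j + 1)) UNIV) < nat (sum b' UNIV - sum a' UNIV)"
        using sum_upd[of a' j 1] sum_less[OF \<open>a' j < b' j\<close>] by simp
    qed (use less.prems in simp)
    then show ?thesis using * by (meson converse_rtranclp_into_rtranclp)
  qed
qed

text \<open>The hypothesis is the form in which rationality is used. If \<open>l = b - a > 0\<close> and neither the top nor the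
  bottom slice in direction \<open>j\<close> could be removed, then \<open>(l, E\<^sub>j) \<ge> E\<^sub>j\<^sup>2 + 2\<close>; this cannot happen for
  all \<open>j\<close> in the support of \<open>l\<close>.\<close>

lemma collapse_box_to_point:
  assumes rational: "\<And>l. (\<And>i. 0 \<le> l i) \<Longrightarrow> l \<noteq> (\<lambda>_. 0) \<Longrightarrow> \<exists>j. 0 < l j \<and> pair l j < A j j + 2"
    and "a \<le> b"
  shows "\<exists>p. (collapses_to f)\<^sup>*\<^sup>* {a..b} {p}"
  using \<open>a \<le> b\<close>
proof (induction "nat ((\<Sum>i\<in>UNIV. b i) - (\<Sum>i\<in>UNIV. a i))" arbitrary: a b rule: less_induct)
  case less
  show ?case
  proof (cases "b = a")
    case True
    then have "{a..b} = {a}" by simp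
    then show ?thesis by (metis rtranclp.rtrancl_refl)
  next
    case False
    define l where "l = (\<lambda>i. b i - a i)"
    have "l \<noteq> (\<lambda>_. 0)" using False by (auto simp: l_def fun_eq_iff)
    moreover have "0 \<le> l i" for i using less.prems by (auto simp: l_def le_fun_def)
    ultimately obtain j where j: "0 < l j" "pair l j < A j j + 2" using rational by blast
    have lt: "a j < b j" using j by (simp add: l_def)
    have sum_less: "(\<Sum>i\<in>UNIV. a i) < (\<Sum>i\<in>UNIV. b i)"
      using lt less.prems by (intro sum_strict_mono_ex1) (auto simp: le_fun_def)
    have "pair b j - pair a j \<le> A j j + 1" using j(2) pair_diff[of b a j] by (simp add: l_def)
    then consider "pair b j \<le> c j + A j j" | "c j \<le> pair a j" by linarith
    then show ?thesis
    proof cases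
      case 1
      have "\<exists>p. (collapses_to f)\<^sup>*\<^sup>* {a..b(j := b j - 1)} {p}"
      proof (rule less.hyps)
        show "a \<le> b(j := b j - 1)" using lt less.prems by (auto simp: le_fun_def)
        show "nat (sum (b(j := b j - 1)) UNIV - sum a UNIV) < nat (sum b UNIV - sum a UNIV)"
          using sum_upd[of b j "- 1"] sum_less by simp
      qed
      then show ?thesis using collapse_top[OF less.prems lt 1] by (meson converse_rtranclp_into_rtranclp)
    next
      case 2
      have "\<exists>p. (collapses_to f)\<^sup>*\<^sup>* {a(j := a j + 1)..b} {p}"
      proof (rule less.hyps)
        show "a(j := a j + 1) \<le> b" using lt less.prems by (auto simp: le_fun_def)
        show "nat (sum b UNIV - sum (a(j := a j + 1)) UNIV) < nat (sum b UNIV - sum a UNIV)"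
          using sum_upd[of a j 1] sum_less by simp
      qed
      then show ?thesis using collapse_bottom[OF less.prems lt 2] by (meson converse_rtranclp_into_rtranclp)
    qed
  qed
qed

text \<open>The boxes \<open>[- (M + n) Z, (M + n) Z]\<close> with \<open>(Z, E\<^sub>j) < 0\<close> for all \<open>j\<close> and a large constant \<open>M\<close>.\<close>

lemma exists_exhaustion:
  "\<exists>a b :: nat \<Rightarrow> 'v \<Rightarrow> int. (\<forall>n. a n \<le> b n) \<and> (\<Union>n. {a n..b n}) = UNIV \<and>
     (\<forall>n. (collapses_to f)\<^sup>*\<^sup>* {a (Suc n)..b (Suc n)} {a n..b n})"
proof -
  obtain Z where Z: "\<And>j. pair Z j < 0" using exists_antinef by blast
  have pos: "1 \<le> Z j" for j using positive_if_pair_negative[OF Z, of j] by simp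
  define M where "M = (\<Sum>j\<in>UNIV. \<bar>c j\<bar> + \<bar>A j j\<bar>)"
  have M: "\<bar>c j\<bar> + \<bar>A j j\<bar> \<le> M" for j
    unfolding M_def by (rule member_le_sum) auto
  have "0 \<le> M" unfolding M_def by (intro sum_nonneg) auto
  define b where "b n j = (M + int n) * Z j" for n :: nat and j
  define a where "a n j = - b n j" for n :: nat and j
  have ab: "a n \<le> b n" for n
  proof -
    have "0 \<le> b n j" for j
      unfolding b_def using pos[of j] \<open>0 \<le> M\<close> by (intro mult_nonneg_nonneg) auto
    then show ?thesis by (simp add: le_fun_def a_def)
  qed
  have mono: "(M + int n) * Z j \<le> (M + int (Suc n)) * Z j" for n j
    using pos[of j] by (intro mult_right_mono) auto
  have "(collapses_to f)\<^sup>*\<^sup>* {a (Suc n)..b (Suc n)} {a n..b n}" for n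
  proof (rule collapse_outer_box[OF ab])
    have Zn: "(M + int n) * pair Z j \<le> - M" for j
    proof -
      have "(M + int n) * pair Z j \<le> (M + int n) * (- 1)"
        using Z[of j] \<open>0 \<le> M\<close> by (intro mult_left_mono) auto
      then show ?thesis by simp
    qed
    show "pair (b n) j \<le> c j + A j j" for j
      using Zn[of j] M[of j] pair_scale[of "M + int n" Z j] unfolding b_def by linarith
    show "c j \<le> pair (a n) j" for j
      using Zn[of j] M[of j] pair_scale[of "M + int n" Z j] pair_uminus[of "b n" j]
      unfolding a_def b_def by linarith
    show "b n \<le> b (Suc n)" "a (Suc n) \<le> a n"
      using mono unfolding le_fun_def a_def b_def by (auto simp only: neg_le_iff_le)
  qed
  moreover have "x \<in> (\<Union>n. {a n..b n})" for x
  proof -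
    define n where "n = nat (\<Sum>j\<in>UNIV. \<bar>x j\<bar>)"
    have x_le: "\<bar>x j\<bar> \<le> (M + int n) * Z j" for j
    proof -
      have "\<bar>x j\<bar> \<le> (\<Sum>j\<in>UNIV. \<bar>x j\<bar>)" by (rule member_le_sum) auto
      also have "\<dots> \<le> int n" by (simp add: n_def)
      also have "\<dots> \<le> (M + int n) * 1" using \<open>0 \<le> M\<close> by simp
      also have "\<dots> \<le> (M + int n) * Z j" using pos[of j] \<open>0 \<le> M\<close> by (intro mult_left_mono) auto
      finally show ?thesis .
    qed
    have "a n j \<le> x j \<and> x j \<le> b n j" for j
      using x_le[of j] unfolding a_def b_def by linarith
    then have "x \<in> {a n..b n}" by (simp add: le_fun_def)
    then show ?thesis by blast
  qed
  then have "(\<Union>n. {a n..b n}) = UNIV" by (rule UNIV_eq_I[symmetric])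
  ultimately show ?thesis using ab by (intro exI[of _ a] exI[of _ b] conjI allI)
qed

lemma bounded_below: "\<exists>m. \<forall>x. m \<le> f x"
proof -
  obtain a b :: "nat \<Rightarrow> 'v \<Rightarrow> int" where cover: "(\<Union>n. {a n..b n}) = UNIV"
    and chain: "\<And>n. (collapses_to f)\<^sup>*\<^sup>* {a (Suc n)..b (Suc n)} {a n..b n}"
    using exists_exhaustion by blast
  have to_0: "(collapses_to f)\<^sup>*\<^sup>* {a n..b n} {a 0..b 0}" for n
    by (induction n) (use chain in \<open>auto intro: rtranclp_trans\<close>)
  have "{a 0..b 0} \<subseteq> Pi\<^sub>E UNIV (\<lambda>i. {a 0 i..b 0 i})" by (auto simp: le_fun_def)
  then have fin: "finite {a 0..b 0}" by (rule finite_subset) (intro finite_PiE; simp)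
  have "Min (f ` {a 0..b 0}) \<le> f x" for x
  proof -
    obtain n where "x \<in> {a n..b n}" using cover by blast
    then obtain y where "y \<in> {a 0..b 0}" "f y \<le> f x" using collapses_below[OF to_0] by blast
    moreover from this have "Min (f ` {a 0..b 0}) \<le> f y" using fin by (intro Min_le) auto
    ultimately show ?thesis by simp
  qed
  then show ?thesis by blast
qed

end

section \<open>First cohomology of line bundles in genus 0\<close>

lemma ex1_implies_uniq: "\<exists>!x. P x \<Longrightarrow> P x \<Longrightarrow> P y \<Longrightarrow> x = y"
  by blast

lemma quotient_dim_pos:
  assumes "quotient_dim Z B n" "0 < n" and zero: "(\<lambda>_. 0) \<in> B"
  shows "\<exists>f\<in>Z. f \<notin> B"
proof -
  obtain v :: "nat \<Rightarrow> 'a \<Rightarrow> complex" where v: "\<forall>i<n. v i \<in> Z"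
    and uniq: "\<forall>f\<in>Z. \<exists>!c::nat \<Rightarrow> complex.
          (\<forall>i\<ge>n. c i = 0) \<and> (\<lambda>x. f x - (\<Sum>i<n. c i * v i x)) \<in> B"
    using assms(1) unfolding quotient_dim_def by (elim exE conjE) (rule that)
  have "v 0 \<notin> B"
  proof
    assume B: "v 0 \<in> B"
    define e where "e i = (if i = 0 then 1 else 0 :: complex)" for i :: nat
    have "(\<Sum>i<n. e i * v i x) = v 0 x" for x
    proof -
      have "(\<Sum>i<n. e i * v i x) = (\<Sum>i<n. if i = 0 then v 0 x else 0)"
        by (intro sum.cong refl) (auto simp: e_def)
      then show ?thesis using assms(2) by simp
    qed
    then have "(\<forall>i\<ge>n. e i = 0) \<and> (\<lambda>x. v 0 x - (\<Sum>i<n. e i * v i x)) \<in> B"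
      using zero assms(2) by (auto simp: e_def)
    moreover have "(\<forall>i\<ge>n. (0::complex) = 0) \<and> (\<lambda>x. v 0 x - (\<Sum>i<n. 0 * v i x)) \<in> B"
      using B by simp
    ultimately have "e = (\<lambda>_. 0)"
      by (rule ex1_implies_uniq[OF bspec[OF uniq v[rule_format, OF assms(2)]]])
    then have "e 0 = 0" by simp
    then show False by (simp add: e_def)
  qed
  then show ?thesis using v assms(2) by blast
qed

lemma quotient_dim_0: "quotient_dim Z B 0 \<Longrightarrow> Z \<subseteq> B"
  unfolding quotient_dim_def by (auto dest!: bspec)

lemma chart_image_open:
  assumes "complex_chart X (U, \<phi>)" "openin X W"
  shows "open (\<phi> ` (U \<inter> W))"
proof -
  have hm: "homeomorphic_map (subtopology X U) (top_of_set (\<phi> ` U)) \<phi>"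
    and o: "open (\<phi> ` U)" "openin X U"
    using assms(1) by (auto simp: complex_chart_def)
  have "openin (subtopology X U) (U \<inter> W)"
    using assms(2) by (metis inf_commute openin_subtopology_Int)
  then have "openin (top_of_set (\<phi> ` U)) (\<phi> ` (U \<inter> W))"
    using homeomorphic_imp_open_map[OF hm] by (auto simp: open_map_def)
  then show ?thesis using o openin_open_trans by blast
qed

lemma chart_preimage_open:
  assumes "complex_chart X (U, \<phi>)" "open B"
  shows "openin X {q\<in>U. \<phi> q \<in> B}"
proof -
  have hm: "homeomorphic_map (subtopology X U) (top_of_set (\<phi> ` U)) \<phi>" and o: "openin X U"
    using assms(1) by (auto simp: complex_chart_def)
  have U: "U \<subseteq> topspace X" using o by (rule openin_subset)
  have "continuous_map (subtopology X U) (top_of_set (\<phi> ` U)) \<phi>"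
    using hm by (rule homeomorphic_imp_continuous_map)
  then have "continuous_map (subtopology X U) euclidean \<phi>"
    by (simp add: continuous_map_in_subtopology)
  then have "openin (subtopology X U) {q\<in>topspace (subtopology X U). \<phi> q \<in> B}"
    using assms(2) by (intro openin_continuous_map_preimage) auto
  moreover have "topspace (subtopology X U) = U" using U by auto
  ultimately show ?thesis using o openin_trans_full by fastforce
qed

lemma chart_inj_on:
  assumes "complex_chart X (U, \<phi>)"
  shows "inj_on \<phi> U"
proof -
  have hm: "homeomorphic_map (subtopology X U) (top_of_set (\<phi> ` U)) \<phi>" and o: "openin X U"
    using assms(1) by (auto simp: complex_chart_def)
  have "topspace (subtopology X U) = U" using openin_subset[OF o] by auto
  then show ?thesis using homeomorphic_imp_injective_map[OF hm] by simp
qed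

lemma holo_fun_subset: "holo_fun A W f \<Longrightarrow> W' \<subseteq> W \<Longrightarrow> holo_fun A W' f"
  unfolding holo_fun_def by (fastforce intro: holomorphic_on_subset)

lemma holo_fun_mult: "holo_fun A W f \<Longrightarrow> holo_fun A W g \<Longrightarrow> holo_fun A W (\<lambda>p. f p * g p)"
  unfolding holo_fun_def comp_def by (fastforce intro: holomorphic_on_mult)

text \<open>A topological space with an atlas of complex charts.\<close>

locale complex_surface =
  fixes X :: "'a topology" and A :: "('a set \<times> ('a \<Rightarrow> complex)) set"
  assumes charts: "\<And>c. c \<in> A \<Longrightarrow> complex_chart X c"
    and charts_cover: "(\<Union>c\<in>A. fst c) = topspace X"
begin

lemma inv_chart [simp]: "(C, \<phi>) \<in> A \<Longrightarrow> q \<in> C \<Longrightarrow> inv_into C \<phi> (\<phi> q) = q"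
  using chart_inj_on[OF charts] by (simp add: inv_into_f_f)

lemma holo_fun_cong:
  assumes "holo_fun A W f" "\<And>p. p \<in> W \<Longrightarrow> f p = g p"
  shows "holo_fun A W g"
  unfolding holo_fun_def
proof (clarify)
  fix C \<phi> assume C: "(C, \<phi>) \<in> A"
  then have "(f \<circ> inv_into C \<phi>) holomorphic_on \<phi> ` (C \<inter> W)"
    using assms(1) by (auto simp: holo_fun_def)
  then show "(g \<circ> inv_into C \<phi>) holomorphic_on \<phi> ` (C \<inter> W)"
    by (rule holomorphic_transform) (use C assms(2) in auto)
qed

lemma holo_fun_divide:
  assumes "holo_fun A W f" "holo_fun A W g" "\<And>p. p \<in> W \<Longrightarrow> g p \<noteq> 0"
  shows "holo_fun A W (\<lambda>p. f p / g p)"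
  unfolding holo_fun_def
proof (clarify)
  fix C \<phi> assume C: "(C, \<phi>) \<in> A"
  then have "(f \<circ> inv_into C \<phi>) holomorphic_on \<phi> ` (C \<inter> W)"
    "(g \<circ> inv_into C \<phi>) holomorphic_on \<phi> ` (C \<inter> W)"
    using assms(1,2) by (auto simp: holo_fun_def)
  then show "((\<lambda>p. f p / g p) \<circ> inv_into C \<phi>) holomorphic_on \<phi> ` (C \<inter> W)"
    unfolding comp_def by (rule holomorphic_on_divide) (use C assms(3) in auto)
qed

lemma holo_fun_local:
  assumes "\<And>i. openin X (V i)" "\<And>i. holo_fun A (V i) f"
  shows "holo_fun A (\<Union>i. V i) f"
  unfolding holo_fun_def
proof (clarify)
  fix C \<phi> assume C: "(C, \<phi>) \<in> A"
  have "(f \<circ> inv_into C \<phi>) holomorphic_on (\<Union>i. \<phi> ` (C \<inter> V i))"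
  proof (rule holomorphic_on_UN_open)
    show "(f \<circ> inv_into C \<phi>) holomorphic_on \<phi> ` (C \<inter> V i)" for i
      using assms(2)[of i] C by (auto simp: holo_fun_def)
    show "open (\<phi> ` (C \<inter> V i))" for i
      using charts[OF C] assms(1) by (rule chart_image_open)
  qed
  moreover have "(\<Union>i. \<phi> ` (C \<inter> V i)) = \<phi> ` (C \<inter> (\<Union>i. V i))" by blast
  ultimately show "(f \<circ> inv_into C \<phi>) holomorphic_on \<phi> ` (C \<inter> (\<Union>i. V i))" by simp
qed

lemma zeros_locally:
  assumes W: "openin X W" "p \<in> W" and f: "holo_fun A W f"
  shows "\<exists>V. openin X V \<and> p \<in> V \<and> V \<subseteq> W \<and> ((\<forall>q\<in>V. f q = 0) \<or> (\<forall>q\<in>V - {p}. f q \<noteq> 0))"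
proof -
  have "p \<in> topspace X" using W openin_subset by blast
  then obtain c where "c \<in> A" "p \<in> fst c" using charts_cover by blast
  then obtain C \<phi> where C: "(C, \<phi>) \<in> A" "p \<in> C" by (metis prod.collapse)
  define F where "F = f \<circ> inv_into C \<phi>"
  have hol: "F holomorphic_on \<phi> ` (C \<inter> W)" using f C by (auto simp: holo_fun_def F_def)
  have "open (\<phi> ` (C \<inter> W))" by (rule chart_image_open[OF charts[OF C(1)] W(1)])
  then obtain e where e: "e > 0" "ball (\<phi> p) e \<subseteq> \<phi> ` (C \<inter> W)"
    using C W open_contains_ball by blast
  have F: "F (\<phi> q) = f q" if "q \<in> C" for q using that C by (simp add: F_def)
  have nhd: "openin X (W \<inter> {q\<in>C. \<phi> q \<in> ball (\<phi> p) r})" for r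
    using W chart_preimage_open[OF charts[OF C(1)], of "ball (\<phi> p) r"] by auto
  show ?thesis
  proof (cases "\<forall>z\<in>ball (\<phi> p) e. F z = 0")
    case True
    have "f q = 0" if "q \<in> C" "\<phi> q \<in> ball (\<phi> p) e" for q
      using True F[OF that(1)] that(2) by metis
    then show ?thesis
      using nhd[of e] W C e by (intro exI[of _ "W \<inter> {q\<in>C. \<phi> q \<in> ball (\<phi> p) e}"]) auto
  next
    case False
    then obtain \<beta> where \<beta>: "\<beta> \<in> ball (\<phi> p) e" "F \<beta> \<noteq> 0" by blast
    have hol': "F holomorphic_on ball (\<phi> p) e" using hol e holomorphic_on_subset by blast
    have "\<exists>r>0. \<forall>z\<in>ball (\<phi> p) r - {\<phi> p}. F z \<noteq> 0"
    proof (cases "F (\<phi> p) = 0")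
      case True
      show ?thesis
        by (rule isolated_zeros[OF hol' open_ball connected_ball _ True \<beta>]) (use e in auto)
    next
      case False
      have "continuous_on (ball (\<phi> p) e) F" using hol' by (rule holomorphic_on_imp_continuous_on)
      then have "isCont F (\<phi> p)" using e by (simp add: continuous_on_eq_continuous_at)
      then obtain r where "r > 0" "\<forall>z. dist (\<phi> p) z < r \<longrightarrow> F z \<noteq> 0"
        using continuous_at_avoid[of "\<phi> p" F 0] False by blast
      then show ?thesis by auto
    qed
    then obtain r where r: "r > 0" "\<And>z. z \<in> ball (\<phi> p) r - {\<phi> p} \<Longrightarrow> F z \<noteq> 0" by blast
    have "f q \<noteq> 0" if "q \<in> C" "\<phi> q \<in> ball (\<phi> p) r" "q \<noteq> p" for q
    proof -
      have "\<phi> q \<noteq> \<phi> p" using that C chart_inj_on[OF charts[OF C(1)]] by (auto dest: inj_onD)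
      then show ?thesis using r(2)[of "\<phi> q"] that F by auto
    qed
    then show ?thesis
      using nhd[of r] W C r(1) by (intro exI[of _ "W \<inter> {q\<in>C. \<phi> q \<in> ball (\<phi> p) r}"]) auto
  qed
qed

text \<open>The identity theorem for sections. The interior \<open>I\<close> of the zero set is open and closed, since zeros of
  a holomorphic function of one variable are either isolated or fill a neighbourhood.\<close>

lemma section_zeros_isolated:
  fixes U :: "'i \<Rightarrow> 'a set"
  assumes conn: "connected_space X"
    and lbundle: "holo_line_bundle X A U t"
    and s: "is_section A U t (topspace X) s"
    and nonzero: "p0 \<in> U i0" "s i0 p0 \<noteq> 0"
    and p: "p \<in> topspace X"
  shows "\<exists>V. openin X V \<and> p \<in> V \<and> (\<forall>q\<in>V - {p}. \<forall>i. q \<in> U i \<longrightarrow> s i q \<noteq> 0)"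
proof -
  have U: "openin X (U i)" "U i \<subseteq> topspace X" for i
    using lbundle openin_subset by (auto simp: holo_line_bundle_def)
  have cover: "\<exists>i. q \<in> U i" if "q \<in> topspace X" for q
    using lbundle that by (auto simp: holo_line_bundle_def)
  have trans: "s i q \<noteq> 0 \<longleftrightarrow> s j q \<noteq> 0" if "q \<in> U i" "q \<in> U j" for i j q
  proof -
    have "s i q = t i j q * s j q" "t i j q \<noteq> 0"
      using that s lbundle U(2) unfolding is_section_def holo_line_bundle_def by blast+
    then show ?thesis by simp
  qed
  define Z where "Z = {q\<in>topspace X. \<forall>i. q \<in> U i \<longrightarrow> s i q = 0}"
  have nz: "q \<in> topspace X - Z \<longleftrightarrow> q \<in> topspace X \<and> (\<forall>i. q \<in> U i \<longrightarrow> s i q \<noteq> 0)" for q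
    using trans cover unfolding Z_def by blast
  have dich: "\<exists>V. openin X V \<and> q \<in> V \<and> (V \<subseteq> Z \<or> V - {q} \<subseteq> topspace X - Z)"
    if q: "q \<in> topspace X" for q
  proof -
    obtain i where i: "q \<in> U i" using cover q by blast
    have "holo_fun A (U i) (s i)"
      using s U(2)[of i] unfolding is_section_def by (metis inf.absorb_iff2)
    then obtain V where V: "openin X V" "q \<in> V" "V \<subseteq> U i"
      "(\<forall>x\<in>V. s i x = 0) \<or> (\<forall>x\<in>V - {q}. s i x \<noteq> 0)"
      using zeros_locally[OF U(1) i] by blast
    have "x \<in> Z \<longleftrightarrow> s i x = 0" if "x \<in> V" for x
      using that V(3) U(2)[of i] trans unfolding Z_def by blast
    then show ?thesis using V U(2)[of i] by (intro exI[of _ V]) blast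
  qed
  define I where "I = \<Union>{V. openin X V \<and> V \<subseteq> Z}"
  have I: "openin X I" "I \<subseteq> Z" unfolding I_def by auto
  have max: "V \<subseteq> I" if "openin X V" "V \<subseteq> Z" for V using that by (auto simp: I_def)
  \<comment> \<open>near a point outside \<open>I\<close> there is at most one zero, so no point of \<open>I\<close>\<close>
  have "\<exists>V. openin X V \<and> q \<in> V \<and> V \<subseteq> topspace X - I" if q: "q \<in> topspace X - I" for q
  proof -
    obtain V where V: "openin X V" "q \<in> V" "V \<subseteq> Z \<or> V - {q} \<subseteq> topspace X - Z"
      using dich q by blast
    then have "V - {q} \<subseteq> topspace X - Z" using max q by blast
    then show ?thesis using V q I(2) by (intro exI[of _ V]) blast
  qed
  then have "openin X (topspace X - I)" by (subst openin_subopen) blast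
  then have "closedin X I" using I openin_subset by (simp add: closedin_def)
  then have "I = {} \<or> I = topspace X" using conn I(1) connected_space_clopen_in by blast
  moreover have "I \<noteq> topspace X" using nonzero I(2) U(2) unfolding Z_def by blast
  ultimately have "I = {}" by blast
  then show ?thesis using dich[OF p] max nz by (metis (no_types, lifting) subset_empty empty_iff subsetD)
qed

text \<open>A nonzero section \<open>s\<close> embeds the structure sheaf into the line bundle with a cokernel supported on the
  isolated zeros of \<open>s\<close>, so that the first cohomology of the bundle is a quotient of that of the structure
  sheaf. On cocycles: after a refinement, each zero of \<open>s\<close> lies in only one member of the cover, and then
  a cocycle of the bundle can be divided by \<open>s\<close>.\<close>

lemma cech_trivial_if_section:
  fixes U :: "'i \<Rightarrow> 'a set"
  assumes conn: "connected_space X"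
    and lbundle: "holo_line_bundle X A U t"
    and s: "is_section A U t (topspace X) s"
    and nonzero: "p0 \<in> U i0" "s i0 p0 \<noteq> 0"
    and genus: "cech_Z1 X A (\<lambda>_::unit. topspace X) (\<lambda>_ _ _. 1) \<subseteq> cech_B1 X A (\<lambda>_::unit. topspace X) (\<lambda>_ _ _. 1)"
  shows "cech_Z1 X A U t \<subseteq> cech_B1 X A U t"
proof
  fix f assume "f \<in> cech_Z1 X A U t"
  then obtain N where N: "N \<in> point_covers X"
    and f_sec: "\<And>x y. x \<in> topspace X \<Longrightarrow> y \<in> topspace X \<Longrightarrow>
      is_section A U t (N x \<inter> N y) (\<lambda>i p. f (x, y, i, p))"
    and f_cocycle: "\<And>x y z i p. x \<in> topspace X \<Longrightarrow> y \<in> topspace X \<Longrightarrow> z \<in> topspace X \<Longrightarrow>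
      p \<in> N x \<inter> N y \<inter> N z \<inter> U i \<Longrightarrow> f (x, z, i, p) = f (x, y, i, p) + f (y, z, i, p)"
    unfolding cech_Z1_def by blast
  have U: "openin X (U i)" "U i \<subseteq> topspace X" for i
    using lbundle openin_subset by (auto simp: holo_line_bundle_def)
  have cover: "\<exists>i. q \<in> U i" if "q \<in> topspace X" for q
    using lbundle that by (auto simp: holo_line_bundle_def)
  have s_trans: "s i q = t i j q * s j q" "t i j q \<noteq> 0" if "q \<in> U i" "q \<in> U j" for i j q
    using that s lbundle U(2) unfolding is_section_def holo_line_bundle_def by blast+
  obtain V where V: "\<And>p. p \<in> topspace X \<Longrightarrow> openin X (V p) \<and> p \<in> V p \<and>
      (\<forall>q\<in>V p - {p}. \<forall>i. q \<in> U i \<longrightarrow> s i q \<noteq> 0)"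
    using section_zeros_isolated[OF conn lbundle s nonzero] by metis
  define M where "M x = N x \<inter> V x" for x
  have M: "openin X (M x)" "x \<in> M x" "M x \<subseteq> N x" "M x \<subseteq> topspace X" if "x \<in> topspace X" for x
    using N V that openin_subset unfolding M_def point_covers_def by blast+
  have M_nz: "s i p \<noteq> 0" if "x \<in> topspace X" "y \<in> topspace X" "x \<noteq> y" "p \<in> M x \<inter> M y" "p \<in> U i" for x y i p
    using that V unfolding M_def by blast
  \<comment> \<open>the diagonal terms are the only ones whose domain may contain a zero of \<open>s\<close>\<close>
  have f_diag: "f (x, x, i, p) = 0" if "x \<in> topspace X" "p \<in> N x" "p \<in> U i" for x i p
    using f_cocycle[of x x x p i] that by simp
  define ix where "ix p = (SOME i. p \<in> U i)" for p
  have ix: "p \<in> U (ix p)" if "p \<in> topspace X" for p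
    using cover[OF that] unfolding ix_def by (rule someI_ex)
  \<comment> \<open>the quotient of \<open>f\<close> by \<open>s\<close> does not depend on the trivialization used to compute it\<close>
  define u where "u = (\<lambda>(x, y, i::unit, p). f (x, y, ix p, p) / s (ix p) p)"
  have u: "u (x, y, j, p) = f (x, y, i, p) / s i p"
    if "x \<in> topspace X" "y \<in> topspace X" "p \<in> N x \<inter> N y" "p \<in> U i" for x y i j p
  proof -
    have p: "p \<in> U (ix p)" using ix that U by blast
    have "f (x, y, i, p) = t i (ix p) p * f (x, y, ix p, p)"
      using f_sec[OF that(1,2)] that p unfolding is_section_def by blast
    then show ?thesis using s_trans[OF that(4) p] by (simp add: u_def)
  qed
  have "u \<in> cech_Z1 X A (\<lambda>_. topspace X) (\<lambda>_ _ _. 1)"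
    unfolding cech_Z1_def
  proof (intro CollectI bexI[of _ M] conjI ballI allI)
    show "M \<in> point_covers X" using M by (simp add: point_covers_def)
  next
    fix x y assume xy: "x \<in> topspace X" "y \<in> topspace X"
    define W where "W = M x \<inter> M y"
    have W: "openin X W" "W \<subseteq> topspace X" "W \<subseteq> N x \<inter> N y" using M xy unfolding W_def by blast+
    have "holo_fun A (W \<inter> U i) (\<lambda>p. u (x, y, j, p))" for i j
    proof (cases "x = y")
      case True
      have "holo_fun A (W \<inter> U i) (\<lambda>p. 0)" by (auto simp: holo_fun_def comp_def)
      then show ?thesis
      proof (rule holo_fun_cong)
        fix p assume "p \<in> W \<inter> U i"
        then show "0 = u (x, y, j, p)"
          using u[OF xy, of p i j] f_diag[of x p i] xy W True by auto
      qed
    next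
      case False
      have "holo_fun A (W \<inter> U i) (\<lambda>p. f (x, y, i, p) / s i p)"
      proof (rule holo_fun_divide)
        have "holo_fun A (N x \<inter> N y \<inter> U i) (\<lambda>p. f (x, y, i, p))"
          using f_sec[OF xy] unfolding is_section_def by blast
        then show "holo_fun A (W \<inter> U i) (\<lambda>p. f (x, y, i, p))"
          by (rule holo_fun_subset) (use W in blast)
        have "holo_fun A (topspace X \<inter> U i) (s i)" using s unfolding is_section_def by blast
        then show "holo_fun A (W \<inter> U i) (s i)" by (rule holo_fun_subset) (use W in blast)
        show "s i p \<noteq> 0" if "p \<in> W \<inter> U i" for p
          using M_nz[OF xy False] that unfolding W_def by blast
      qed
      then show ?thesis
        by (rule holo_fun_cong) (use u[OF xy] W in force)
    qed
    then have "holo_fun A (\<Union>i. W \<inter> U i) (\<lambda>p. u (x, y, j, p))" for j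
      by (intro holo_fun_local) (use W U in auto)
    moreover have "(\<Union>i. W \<inter> U i) = W \<inter> topspace X"
      using subsetD[OF U(2)] cover by blast
    ultimately show "is_section A (\<lambda>_. topspace X) (\<lambda>_ _ _. 1) (M x \<inter> M y) (\<lambda>i p. u (x, y, i, p))"
      unfolding is_section_def W_def by simp
  next
    fix x y z i p assume xyz: "x \<in> topspace X" "y \<in> topspace X" "z \<in> topspace X"
      and p: "p \<in> M x \<inter> M y \<inter> M z \<inter> topspace X"
    have "p \<in> N x \<inter> N y \<inter> N z \<inter> U (ix p)" using p M(3) xyz ix by blast
    then have "f (x, z, ix p, p) = f (x, y, ix p, p) + f (y, z, ix p, p)"
      by (rule f_cocycle[OF xyz])
    then show "u (x, z, i, p) = u (x, y, i, p) + u (y, z, i, p)"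
      by (simp add: u_def add_divide_distrib)
  qed
  then have uB: "u \<in> cech_B1 X A (\<lambda>_. topspace X) (\<lambda>_ _ _. 1)" using genus by blast
  obtain N' and h :: "'a \<Rightarrow> unit \<Rightarrow> 'a \<Rightarrow> complex" where N': "N' \<in> point_covers X"
    and h: "\<forall>x\<in>topspace X. is_section A (\<lambda>_. topspace X) (\<lambda>_ _ _. 1) (N' x) (h x)"
    and uh: "\<forall>x\<in>topspace X. \<forall>y\<in>topspace X. \<forall>i. \<forall>p\<in>N' x \<inter> N' y \<inter> topspace X.
        u (x, y, i, p) = h y i p - h x i p"
    using uB unfolding cech_B1_def mem_Collect_eq by (elim bexE exE conjE) (rule that)
  define M' where "M' x = M x \<inter> N' x" for x
  have M': "openin X (M' x)" "x \<in> M' x" "M' x \<subseteq> topspace X" if "x \<in> topspace X" for x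
    using M N' that unfolding M'_def point_covers_def by blast+
  show "f \<in> cech_B1 X A U t"
    unfolding cech_B1_def
  proof (intro CollectI bexI[of _ M'] exI[of _ "\<lambda>x i p. h x () p * s i p"] conjI ballI allI)
    show "M' \<in> point_covers X" using M' by (simp add: point_covers_def)
  next
    fix x assume x: "x \<in> topspace X"
    have "holo_fun A (M' x \<inter> U i) (\<lambda>p. h x () p * s i p)" for i
    proof (rule holo_fun_mult)
      have "holo_fun A (N' x \<inter> topspace X) (h x ())" using bspec[OF h x] unfolding is_section_def by blast
      then show "holo_fun A (M' x \<inter> U i) (h x ())"
        by (rule holo_fun_subset) (use M'(3)[OF x] in \<open>auto simp: M'_def\<close>)
      have "holo_fun A (topspace X \<inter> U i) (s i)" using s unfolding is_section_def by blast
      then show "holo_fun A (M' x \<inter> U i) (s i)"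
        by (rule holo_fun_subset) (use M'(3)[OF x] in blast)
    qed
    moreover have "h x () p * s i p = t i j p * (h x () p * s j p)" if "p \<in> U i" "p \<in> U j" for i j p
      using s_trans(1)[OF that] by simp
    ultimately show "is_section A U t (M' x) (\<lambda>i p. h x () p * s i p)"
      unfolding is_section_def by blast
  next
    fix x y i p assume xy: "x \<in> topspace X" "y \<in> topspace X" and p: "p \<in> M' x \<inter> M' y \<inter> U i"
    have pN: "p \<in> N x \<inter> N y" "p \<in> U i" "p \<in> M x \<inter> M y" "p \<in> N' x \<inter> N' y \<inter> topspace X"
      using p M(3)[OF xy(1)] M(3)[OF xy(2)] U(2)[of i] unfolding M'_def by blast+
    show "f (x, y, i, p) = h y () p * s i p - h x () p * s i p"
    proof (cases "x = y")
      case True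
      then show ?thesis using f_diag[OF xy(1)] pN by simp
    next
      case False
      then have "s i p \<noteq> 0" using M_nz[OF xy False] pN by blast
      moreover have "f (x, y, i, p) / s i p = h y () p - h x () p"
        using u[OF xy pN(1,2), of "()"] uh[rule_format, OF xy pN(4), of "()"] by simp
      ultimately show ?thesis by (simp add: field_simps)
    qed
  qed
qed

end

text \<open>A bundle with \<open>h\<^sup>0 - h\<^sup>1 \<ge> 0\<close> and \<open>h\<^sup>1 > 0\<close> would have a nonzero section, which forces \<open>h\<^sup>1 = 0\<close>. Neither the
  classification of surfaces of genus 0 nor that of their line bundles is needed; whether there is such a
  surface does not matter either, as the supremum of the empty set of naturals is 0.\<close>

lemma max_h1_genus_0: "max_h1 0 n = 0"
proof -
  have "h1 = 0"
    if crs: "compact_riemann_surface X A" and g: "has_genus X A 0" and b: "holo_line_bundle X A U t"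
      and h0: "dim_H0 X A U t h0" and h1: "dim_H1 X A U t h1" and rr: "int h0 - int h1 = int n"
    for X :: "complex topology" and A and U :: "nat \<Rightarrow> complex set" and t h0 h1
  proof (rule ccontr)
    assume "h1 \<noteq> 0"
    interpret complex_surface X A
      using crs by unfold_locales (auto simp: compact_riemann_surface_def)
    have "0 < h0" using \<open>h1 \<noteq> 0\<close> rr by simp
    then obtain s where s: "is_section A U t (topspace X) (curry s)" "\<not> (\<forall>i. \<forall>p\<in>U i. s (i, p) = 0)"
      using quotient_dim_pos[OF h0[unfolded dim_H0_def]] by auto
    then obtain i0 p0 where nz: "p0 \<in> U i0" "curry s i0 p0 \<noteq> 0" by auto
    have conn: "connected_space X" using crs by (simp add: compact_riemann_surface_def)
    have "cech_Z1 X A (\<lambda>_::unit. topspace X) (\<lambda>_ _ _. 1) \<subseteq> cech_B1 X A (\<lambda>_::unit. topspace X) (\<lambda>_ _ _. 1)"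
      using g unfolding has_genus_def dim_H1_def by (rule quotient_dim_0)
    from cech_trivial_if_section[OF conn b s(1) nz this]
    have sub: "cech_Z1 X A U t \<subseteq> cech_B1 X A U t" .
    have "(\<lambda>_. 0) \<in> cech_B1 X A U t"
      unfolding cech_B1_def
      by (intro CollectI bexI[of _ "\<lambda>_. topspace X"] exI[of _ "\<lambda>_ _ _. 0"])
         (auto simp: is_section_def holo_fun_def comp_def point_covers_def)
    then show False
      using quotient_dim_pos[OF h1[unfolded dim_H1_def]] \<open>h1 \<noteq> 0\<close> sub by auto
  qed
  then have "{h1. \<exists>(X :: complex topology) A (U :: nat \<Rightarrow> complex set) t h0.
     compact_riemann_surface X A \<and> has_genus X A 0 \<and> holo_line_bundle X A U t \<and>
     dim_H0 X A U t h0 \<and> dim_H1 X A U t h1 \<and> int h0 - int h1 = int n} \<subseteq> {0}"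
    by blast
  then have "\<exists>S\<subseteq>{0}. max_h1 0 n = Sup S" unfolding max_h1_def by blast
  then show ?thesis by (auto simp: subset_singleton_iff)
qed

section \<open>Rational plumbing graphs\<close>

text \<open>The matrix \<open>(E\<^sub>i, E\<^sub>j)\<close>.\<close>

definition intersection_matrix :: "'v plumbing \<Rightarrow> 'v \<Rightarrow> 'v \<Rightarrow> int" where
  "intersection_matrix G i j = (if i = j then eul G i else int (edges G i j))"

lemma inter_form_eq:
  "inter_form G x y = (\<Sum>j\<in>UNIV. y j * (\<Sum>i\<in>UNIV. x i * of_int (intersection_matrix G i j)))"
proof -
  have "inter_form G x y = (\<Sum>i\<in>UNIV. \<Sum>j\<in>UNIV. x i * y j * of_int (intersection_matrix G i j))"
    unfolding inter_form_def by (intro sum.cong refl) (simp add: intersection_matrix_def)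
  also have "\<dots> = (\<Sum>j\<in>UNIV. \<Sum>i\<in>UNIV. x i * y j * of_int (intersection_matrix G i j))"
    by (rule sum.swap)
  also have "\<dots> = (\<Sum>j\<in>UNIV. y j * (\<Sum>i\<in>UNIV. x i * of_int (intersection_matrix G i j)))"
    by (intro sum.cong refl) (simp add: sum_distrib_left algebra_simps)
  finally show ?thesis .
qed

lemma inter_form_basis:
  "inter_form G x (rvec (basis_vec j)) = (\<Sum>i\<in>UNIV. x i * of_int (intersection_matrix G i j))"
proof -
  have "inter_form G x (rvec (basis_vec j)) =
      (\<Sum>m\<in>UNIV. if m = j then (\<Sum>i\<in>UNIV. x i * of_int (intersection_matrix G i j)) else 0)"
    unfolding inter_form_eq by (intro sum.cong refl) (auto simp: rvec_def basis_vec_def)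
  then show ?thesis by simp
qed

locale negative_definite_plumbing =
  fixes G :: "'v::finite plumbing"
  assumes graph: "plumbing_graph G" and negative: "negative_definite G"
begin

sublocale negative_definite_form "intersection_matrix G"
proof
  show "intersection_matrix G i j = intersection_matrix G j i" for i j
    using graph by (simp add: intersection_matrix_def plumbing_graph_def)
  show "0 \<le> intersection_matrix G i j" if "i \<noteq> j" for i j
    using that by (simp add: intersection_matrix_def)
  show "(\<Sum>j\<in>UNIV. l j * (\<Sum>i\<in>UNIV. l i * intersection_matrix G i j)) < 0" if "l \<noteq> (\<lambda>_. 0)" for l
  proof -
    have "rat_of_int (\<Sum>j\<in>UNIV. l j * (\<Sum>i\<in>UNIV. l i * intersection_matrix G i j)) =
        inter_form G (rvec l) (rvec l)"
      by (simp add: inter_form_eq rvec_def)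
    also have "\<dots> < 0" using negative that by (simp add: negative_definite_def)
    finally show ?thesis by (simp only: of_int_less_0_iff)
  qed
qed

lemma canonical_class_basis:
  "inter_form G (canonical_class G) (rvec (basis_vec j)) = of_int (- eul G j - 2 + 2 * int (gen G j))"
proof -
  let ?P = "\<lambda>x. \<forall>j. inter_form G x (rvec (basis_vec j)) = of_int (- eul G j - 2 + 2 * int (gen G j))"
  have "\<exists>!x. ?P x"
  proof (rule ex_ex1I)
    show "\<exists>x. ?P x" unfolding inter_form_basis by (rule nondegenerate)
  next
    fix x y assume "?P x" "?P y"
    then have "(\<Sum>i\<in>UNIV. (x i - y i) * of_int (intersection_matrix G i j)) = 0" for j
      unfolding inter_form_basis by (simp add: left_diff_distrib sum_subtractf)
    then have "x i - y i = 0" for i by (rule kernel_trivial)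
    then show "x = y" by auto
  qed
  then have "?P (canonical_class G)" unfolding canonical_class_def by (rule theI')
  then show ?thesis by blast
qed

text \<open>\<open>(k, E\<^sub>j)\<close> has the parity of \<open>E\<^sub>j\<^sup>2\<close>, so that the number \<open>\<chi>\<^sub>k(E\<^sub>j)\<close>, namely \<open>1 - g\<^sub>j - m\<^sub>j\<close>, is an
  integer.\<close>

lemma characteristic_basis:
  assumes "k \<in> characteristic G"
  shows "\<exists>m :: 'v \<Rightarrow> int. \<forall>j. inter_form G k (rvec (basis_vec j)) =
    of_int (- eul G j - 2 + 2 * int (gen G j) + 2 * m j)"
proof -
  obtain l' where l': "l' \<in> dual_lattice G" "k = (\<lambda>j. canonical_class G j + 2 * l' j)"
    using assms by (auto simp: characteristic_def)
  have "\<exists>m. inter_form G k (rvec (basis_vec j)) = of_int (- eul G j - 2 + 2 * int (gen G j) + 2 * m)" for j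
  proof -
    obtain m where m: "inter_form G l' (rvec (basis_vec j)) = of_int m"
      using l'(1) by (auto simp: dual_lattice_def elim: Ints_cases)
    have "inter_form G k (rvec (basis_vec j)) =
        inter_form G (canonical_class G) (rvec (basis_vec j)) + 2 * inter_form G l' (rvec (basis_vec j))"
      unfolding inter_form_basis l'(2) by (simp add: distrib_right sum.distrib sum_distrib_left mult.assoc)
    then show ?thesis using m canonical_class_basis by (intro exI[of _ m]) simp
  qed
  then show ?thesis by metis
qed

lemma chi_eq:
  assumes "\<And>j. inter_form G k (rvec (basis_vec j)) = of_int (\<kappa> j)"
  shows "chi G k l = \<lfloor>- rat_of_int (\<Sum>j\<in>UNIV. l j * (pair l j + \<kappa> j)) / 2\<rfloor>"
proof -
  have swap: "inter_form G x y = inter_form G y x" for x y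
    unfolding inter_form_def
    by (subst sum.swap, intro sum.cong refl) (use graph in \<open>auto simp: plumbing_graph_def\<close>)
  have "inter_form G (rvec l) (\<lambda>j. rvec l j + k j) = inter_form G (\<lambda>j. rvec l j + k j) (rvec l)"
    by (rule swap)
  also have "\<dots> = (\<Sum>j\<in>UNIV. of_int (l j) * (of_int (pair l j) + inter_form G k (rvec (basis_vec j))))"
    unfolding inter_form_eq[of G _ "rvec l"] inter_form_basis
    by (intro sum.cong refl) (simp add: rvec_def pair_def distrib_right sum.distrib)
  also have "\<dots> = rat_of_int (\<Sum>j\<in>UNIV. l j * (pair l j + \<kappa> j))"
    by (simp add: assms)
  finally show ?thesis by (simp add: chi_def)
qed

text \<open>The increments of \<open>\<chi>\<close> are integers before rounding down, so the floor in its definition commutes with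
  them.\<close>

lemma chi_riemann_roch:
  assumes "\<And>j. inter_form G k (rvec (basis_vec j)) = of_int (- eul G j - 2 + 2 * int (gen G j) + 2 * m j)"
  shows "riemann_roch_function (intersection_matrix G) (chi G k) (\<lambda>j. 1 - int (gen G j) - m j)"
proof unfold_locales
  fix x j
  define \<kappa> where "\<kappa> j = - eul G j - 2 + 2 * int (gen G j) + 2 * m j" for j
  define Q where "Q x = (\<Sum>i\<in>UNIV. x i * (pair x i + \<kappa> i))" for x
  have chi: "chi G k l = \<lfloor>- rat_of_int (Q l) / 2\<rfloor>" for l
    unfolding Q_def by (rule chi_eq) (use assms in \<open>simp add: \<kappa>_def\<close>)
  have "Q (x(j := x j + 1)) = Q x + 2 * pair x j + intersection_matrix G j j + \<kappa> j"
    unfolding Q_def by (rule quadratic_step)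
  also have "\<dots> = Q x + 2 * (pair x j - 1 + int (gen G j) + m j)"
    by (simp add: \<kappa>_def intersection_matrix_def)
  finally have "- rat_of_int (Q (x(j := x j + 1))) / 2 =
      - rat_of_int (Q x) / 2 + of_int (1 - int (gen G j) - m j - pair x j)"
    by (simp add: field_simps)
  then have "chi G k (x(j := x j + 1)) =
      \<lfloor>- rat_of_int (Q x) / 2 + of_int (1 - int (gen G j) - m j - pair x j)\<rfloor>"
    by (simp only: chi)
  then show "chi G k (x(j := x j + 1)) = chi G k x + (1 - int (gen G j) - m j) - pair x j"
    by (simp only: floor_add_int[symmetric] chi)
qed

text \<open>The infimum in the definition of rationality is a genuine lower bound because \<open>\<chi>\<close> is bounded below.\<close>

lemma rational_chi_pos:
  assumes "rational_graph G" "\<And>i. 0 \<le> l i" "l \<noteq> (\<lambda>_. 0)"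
  shows "0 < chi G (canonical_class G) l"
proof -
  interpret riemann_roch_function "intersection_matrix G" "chi G (canonical_class G)"
      "\<lambda>j. 1 - int (gen G j) - 0"
    by (rule chi_riemann_roch) (simp add: canonical_class_basis)
  obtain b where "\<And>x. b \<le> chi G (canonical_class G) x" using bounded_below by blast
  then have "bdd_below (chi G (canonical_class G) ` (effective - {\<lambda>_. 0}))"
    by (intro bdd_belowI[of _ b]) auto
  then have "Inf (chi G (canonical_class G) ` (effective - {\<lambda>_. 0})) \<le> chi G (canonical_class G) l"
    using assms by (intro cInf_lower) (auto simp: effective_def)
  then show ?thesis using assms(1) by (simp add: rational_graph_def)
qed

text \<open>\<open>\<chi>\<^sub>K(E\<^sub>j) = 1 - g\<^sub>j\<close> is positive.\<close>

lemma rational_genus_0: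
  assumes "rational_graph G"
  shows "gen G j = 0"
proof -
  interpret riemann_roch_function "intersection_matrix G" "chi G (canonical_class G)"
      "\<lambda>j. 1 - int (gen G j) - 0"
    by (rule chi_riemann_roch) (simp add: canonical_class_basis)
  define z where "z = (\<lambda>_::'v. 0::int)"
  have "chi G (canonical_class G) z = 0"
    by (simp add: chi_def inter_form_def rvec_def z_def)
  moreover have "pair z j = 0" by (simp add: pair_def z_def)
  ultimately have "chi G (canonical_class G) (z(j := z j + 1)) = 1 - int (gen G j)"
    using f_step[of z j] by simp
  moreover have "0 < chi G (canonical_class G) (z(j := z j + 1))"
    by (rule rational_chi_pos[OF assms]) (auto simp: z_def fun_eq_iff)
  ultimately show ?thesis by simp
qed

text \<open>Otherwise \<open>(l + K, E\<^sub>j) \<ge> 0\<close> for all \<open>j\<close> in the support of \<open>l\<close>, hence \<open>(l, l + K) \<ge> 0\<close> and \<open>\<chi>\<^sub>K(l) \<le> 0\<close>. The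
  conclusion does not mention a characteristic element any more, which is why rationality, a
  condition on \<open>\<chi>\<^sub>K\<close>, has consequences for all \<open>k\<close>.\<close>

lemma rational_direction:
  assumes "rational_graph G" "\<And>i. 0 \<le> l i" "l \<noteq> (\<lambda>_. 0)"
  shows "\<exists>j. 0 < l j \<and> pair l j < intersection_matrix G j j + 2"
proof (rule ccontr)
  assume *: "\<nexists>j. 0 < l j \<and> pair l j < intersection_matrix G j j + 2"
  define \<kappa> where "\<kappa> j = - eul G j - 2" for j
  have "0 \<le> l j * (pair l j + \<kappa> j)" for j
  proof (cases "l j = 0")
    case False
    then have "0 < l j" using assms(2)[of j] by simp
    then have "0 \<le> pair l j + \<kappa> j"
      using * unfolding \<kappa>_def intersection_matrix_def by force
    then show ?thesis using \<open>0 < l j\<close> by simp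
  qed simp
  then have "0 \<le> (\<Sum>j\<in>UNIV. l j * (pair l j + \<kappa> j))" by (intro sum_nonneg) auto
  then have "- rat_of_int (\<Sum>j\<in>UNIV. l j * (pair l j + \<kappa> j)) / 2 \<le> 0"
    by (simp only: of_int_0_le_iff divide_nonpos_pos neg_le_0_iff_le zero_less_numeral)
  then have "\<lfloor>- rat_of_int (\<Sum>j\<in>UNIV. l j * (pair l j + \<kappa> j)) / 2\<rfloor> \<le> 0"
    using floor_mono by fastforce
  moreover have "chi G (canonical_class G) l = \<lfloor>- rat_of_int (\<Sum>j\<in>UNIV. l j * (pair l j + \<kappa> j)) / 2\<rfloor>"
    by (rule chi_eq) (simp add: canonical_class_basis rational_genus_0[OF assms(1)] \<kappa>_def)
  ultimately have "chi G (canonical_class G) l \<le> 0"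
    by (simp only:)
  then show False using rational_chi_pos[OF assms] by simp
qed

end

lemma weight_eq_Max:
  assumes gen: "\<And>j. gen G j = 0"
  shows "weight G k (l, I) = Max ((\<lambda>J. chi G k (shift l J)) ` Pow I)"
proof (cases "I = {}")
  case True
  then show ?thesis by (simp add: weight_def)
next
  case False
  define S where "S = {weight1 G k (shift l J) j |j J. j \<in> I \<and> J \<subseteq> I - {j}}"
  have w1: "weight1 G k (shift l J) j = max (chi G k (shift l J)) (chi G k (shift l (insert j J)))"
    if "J \<subseteq> I - {j}" for j J
  proof -
    have "shift (shift l J) {j} = shift l (J \<union> {j})" using that by (intro shift_shift) auto
    then show ?thesis by (simp add: weight1_def gen max_h1_genus_0)
  qed
  have "S = (\<lambda>(j, J). weight1 G k (shift l J) j) ` (SIGMA j:I. Pow (I - {j}))"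
    by (auto simp: S_def)
  then have fin: "finite S" by simp
  have "S \<noteq> {}" using False by (auto simp: S_def)
  have "Max S = Max ((\<lambda>J. chi G k (shift l J)) ` Pow I)"
  proof (rule antisym)
    have "n \<le> Max ((\<lambda>J. chi G k (shift l J)) ` Pow I)" if n: "n \<in> S" for n
    proof -
      obtain j J where jJ: "j \<in> I" "J \<subseteq> I - {j}" "n = weight1 G k (shift l J) j"
        using n by (auto simp: S_def)
      have "chi G k (shift l J) \<le> Max ((\<lambda>J. chi G k (shift l J)) ` Pow I)"
        "chi G k (shift l (insert j J)) \<le> Max ((\<lambda>J. chi G k (shift l J)) ` Pow I)"
        using jJ by (auto intro!: Max_ge)
      then show ?thesis using w1[OF jJ(2)] jJ(3) by simp
    qed
    then show "Max S \<le> Max ((\<lambda>J. chi G k (shift l J)) ` Pow I)"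
      using fin \<open>S \<noteq> {}\<close> by simp
  next
    have "chi G k (shift l J) \<le> Max S" if J: "J \<subseteq> I" for J
    proof -
      obtain j where j: "j \<in> I" using False by blast
      have "J - {j} \<subseteq> I - {j}" using J by auto
      then have "max (chi G k (shift l (J - {j}))) (chi G k (shift l (insert j (J - {j})))) \<in> S"
        using w1[of "J - {j}" j] j unfolding S_def by (auto intro!: exI[of _ j] exI[of _ "J - {j}"])
      then have "max (chi G k (shift l (J - {j}))) (chi G k (shift l (insert j (J - {j})))) \<le> Max S"
        using fin by (rule Max_ge[rotated])
      moreover have "J = J - {j} \<or> J = insert j (J - {j})" by blast
      ultimately show ?thesis by (metis max.bounded_iff)
    qed
    then show "Max ((\<lambda>J. chi G k (shift l J)) ` Pow I) \<le> Max S"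
      by (subst Max_le_iff) auto
  qed
  then show ?thesis using False by (simp add: weight_def S_def)
qed

theorem proposition4p1p4:
  fixes G :: "'v::{finite,linorder} plumbing" and k :: "'v \<Rightarrow> rat"
  assumes "plumbing_graph G" and "connected_graph G" and "negative_definite G"
    and "rational_graph G" and "k \<in> characteristic G"
  shows "\<forall>q. trivial_group (reduced_lattice_cohomology G k q)"
proof
  fix q
  interpret negative_definite_plumbing G
    by unfold_locales (use assms in auto)
  obtain m :: "'v \<Rightarrow> int" where "\<And>j. inter_form G k (rvec (basis_vec j)) =
      of_int (- eul G j - 2 + 2 * int (gen G j) + 2 * m j)"
    using characteristic_basis[OF assms(5)] by blast
  then interpret rr: riemann_roch_function "intersection_matrix G" "chi G k" "\<lambda>j. 1 - int (gen G j) - m j"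
    by (rule chi_riemann_roch)
  interpret max_weight G k
    by unfold_locales (rule weight_eq_Max, rule rational_genus_0[OF assms(4)])
  obtain a b :: "nat \<Rightarrow> 'v \<Rightarrow> int" where ab: "\<And>n. a n \<le> b n" and cover: "(\<Union>n. {a n..b n}) = UNIV"
    and chain: "\<And>n. (collapses_to (chi G k))\<^sup>*\<^sup>* {a (Suc n)..b (Suc n)} {a n..b n}"
    using rr.exists_exhaustion by blast
  obtain p where "(collapses_to (chi G k))\<^sup>*\<^sup>* {a 0..b 0} {p}"
    using rr.collapse_box_to_point[OF rational_direction[OF assms(4)] ab[of 0]] by blast
  then have "cocycles G k q = reduced_coboundaries G k q"
    using chain cover by (rule cocycles_eq_reduced_coboundaries)
  then show "trivial_group (reduced_lattice_cohomology G k q)"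
    by (rule trivial_reduced_cohomology)
qed

end
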